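(* Let $p$ be an odd prime, let $\rho$ be a non-trivial irreducible complex representation of $GL(2,\mathbb{F}_p)$ of dimension $d(\rho)$, and let $c>0$ be a constant. Let $\mathbf{I}=\prod_{1\leq i,j\leq 2}I_{ij}$ be a matrix interval over the integers such that each component interval satisfies $|I_{ij}|\leq cp$. Then $$\sum_{A\in\mathbf{I}}\chi_\rho(A)\ \ll\ d(\rho)\,p^{2}(\log p)^{4},$$ where for $p\geq 11$ the implied constant can be taken to be $\left(\frac{c+3}{2}\right)^{4}$.
   Context: $\mathbb{F}_p=\mathbb{Z}/p\mathbb{Z}$. For an irreducible complex representation $\rho$ of $GL(2,\mathbb{F}_p)$, $\chi_\rho=\mathrm{Tr}\circ\rho$ is its character, extended to $M(2,\mathbb{F}_p)$ by $0$ on singular matrices and regarded as a function on $M(2,\mathbb{Z})$ via reduction mod $p$. A matrix interval $\mathbf{I}=\prod_{1\leq i,j\leq 2}I_{ij}$ is the set of integer matrices $(a_{ij})$ with $a_{ij}\in I_{ij}$ for each $(i,j)$, where each $I_{ij}$ is an interval in $\mathbb{Z}$; $|I_{ij}|$ is the number of integers in $I_{ij}$. *)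

theory Defs
  imports
    "HOL-Number_Theory.Residues"
    "Jordan_Normal_Form.VS_Connect"
begin

(* The prime is a term rather than a type here, so that an implied constant can be
   quantified before it.  A matrix over Z/pZ is represented by its unique integer
   representative with entries in {0..p-1}. *)

definition mat_mod :: "nat \<Rightarrow> int mat \<Rightarrow> int mat" where
  "mat_mod p A = map_mat (\<lambda>x. x mod int p) A"

definition M2 :: "nat \<Rightarrow> int mat monoid" where
  "M2 p = \<lparr>carrier = {A \<in> carrier_mat 2 2. elements_mat A \<subseteq> carrier (residue_ring (int p))},
           monoid.mult = (\<lambda>A B. mat_mod p (A * B)),
           one = 1\<^sub>m 2\<rparr>"

definition GL2 :: "nat \<Rightarrow> int mat monoid" where
  "GL2 p = units_of (M2 p)"

definition GL_complex :: "nat \<Rightarrow> complex mat monoid" where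
  "GL_complex d = units_of (ring_mat TYPE(complex) d ())"

definition mat_trace :: "'a :: comm_monoid_add mat \<Rightarrow> 'a" where
  "mat_trace A = (\<Sum>i<dim_row A. A $$ (i, i))"

definition representation :: "('g, 'm) monoid_scheme \<Rightarrow> nat \<Rightarrow> ('g \<Rightarrow> complex mat) \<Rightarrow> bool" where
  "representation G d \<rho> \<longleftrightarrow> \<rho> \<in> hom G (GL_complex d)"

definition irreducible_representation ::
    "('g, 'm) monoid_scheme \<Rightarrow> nat \<Rightarrow> ('g \<Rightarrow> complex mat) \<Rightarrow> bool" where
  "irreducible_representation G d \<rho> \<longleftrightarrow>
     representation G d \<rho> \<and> d > 0 \<and>
     (\<forall>W. VectorSpace.subspace class_ring W (module_vec TYPE(complex) d) \<longrightarrow>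
          (\<forall>g\<in>carrier G. \<forall>w\<in>W. \<rho> g *\<^sub>v w \<in> W) \<longrightarrow>
          W = {0\<^sub>v d} \<or> W = carrier_vec d)"

(* An irreducible representation satisfying this is necessarily one-dimensional. *)
definition trivial_representation ::
    "('g, 'm) monoid_scheme \<Rightarrow> nat \<Rightarrow> ('g \<Rightarrow> complex mat) \<Rightarrow> bool" where
  "trivial_representation G d \<rho> \<longleftrightarrow> (\<forall>g\<in>carrier G. \<rho> g = 1\<^sub>m d)"

definition char_GL2 :: "nat \<Rightarrow> (int mat \<Rightarrow> complex mat) \<Rightarrow> int mat \<Rightarrow> complex" where
  "char_GL2 p \<rho> A =
     (if mat_mod p A \<in> carrier (GL2 p) then mat_trace (\<rho> (mat_mod p A)) else 0)"

definition matrix_interval :: "(nat \<Rightarrow> nat \<Rightarrow> int set) \<Rightarrow> int mat set" where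
  "matrix_interval I = {A \<in> carrier_mat 2 2. \<forall>i<2. \<forall>j<2. A $$ (i, j) \<in> I i j}"

lemma M2_carrier_iff:
  assumes "p > 0"
  shows "A \<in> carrier (M2 p) \<longleftrightarrow> A \<in> carrier_mat 2 2 \<and> mat_mod p A = A"
proof -
  have "elements_mat A \<subseteq> {0..int p - 1} \<longleftrightarrow> mat_mod p A = A" if "A \<in> carrier_mat 2 2"
  proof
    assume "elements_mat A \<subseteq> {0..int p - 1}"
    then show "mat_mod p A = A"
      unfolding mat_mod_def elements_mat_def by (intro eq_matI) (fastforce intro!: mod_pos_pos_trivial)+
  next
    assume *: "mat_mod p A = A"
    have "A $$ (i, j) \<in> {0..int p - 1}" if "i < dim_row A" "j < dim_col A" for i j
    proof -
      have "A $$ (i, j) = A $$ (i, j) mod int p"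
        using arg_cong[OF *, of "\<lambda>M. M $$ (i, j)"] that by (simp add: mat_mod_def)
      then show ?thesis
        using assms pos_mod_bound[of "int p" "A $$ (i, j)"] pos_mod_sign[of "int p" "A $$ (i, j)"]
        by simp
    qed
    then show "elements_mat A \<subseteq> {0..int p - 1}"
      unfolding elements_mat_def by auto
  qed
  then show ?thesis
    by (auto simp: M2_def residue_ring_def)
qed

lemma mat_mod_carrier [simp]: "mat_mod p A \<in> carrier_mat n m \<longleftrightarrow> A \<in> carrier_mat n m"
  by (simp add: mat_mod_def)

lemma mat_mod_eq_iff:
  "mat_mod p A = mat_mod p B \<longleftrightarrow> dim_row A = dim_row B \<and> dim_col A = dim_col B \<and>
     (\<forall>i<dim_row A. \<forall>j<dim_col A. [A $$ (i, j) = B $$ (i, j)] (mod int p))"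
  by (auto simp: mat_mod_def mat_eq_iff cong_def)

lemma mat_mod_mult:
  assumes "A \<in> carrier_mat n n" "B \<in> carrier_mat n n"
  shows mat_mod_mult_left: "mat_mod p (mat_mod p A * B) = mat_mod p (A * B)"
    and mat_mod_mult_right: "mat_mod p (A * mat_mod p B) = mat_mod p (A * B)"
  using assms unfolding mat_mod_eq_iff
  by (auto simp: mat_mod_def scalar_prod_def intro!: cong_sum cong_mult)

lemma mat_mod_idem [simp]: "mat_mod p (mat_mod p A) = mat_mod p A"
  by (auto simp: mat_mod_def)

lemma one_in_M2: "p > 1 \<Longrightarrow> 1\<^sub>m 2 \<in> carrier (M2 p)"
  by (auto simp: M2_carrier_iff mat_mod_def)

lemma monoid_M2:
  assumes "p > 1"
  shows "monoid (M2 p)"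
proof (rule monoidI)
  fix A B C assume "A \<in> carrier (M2 p)" "B \<in> carrier (M2 p)" "C \<in> carrier (M2 p)"
  then have *: "A \<in> carrier_mat 2 2" "B \<in> carrier_mat 2 2" "C \<in> carrier_mat 2 2"
    using assms by (auto simp: M2_carrier_iff)
  show "A \<otimes>\<^bsub>M2 p\<^esub> B \<otimes>\<^bsub>M2 p\<^esub> C = A \<otimes>\<^bsub>M2 p\<^esub> (B \<otimes>\<^bsub>M2 p\<^esub> C)"
    using * mat_mod_mult[of "A * B" 2 C p] mat_mod_mult[of A 2 "B * C" p]
    by (simp add: M2_def)
next
  fix A B assume "A \<in> carrier (M2 p)" "B \<in> carrier (M2 p)"
  with assms show "A \<otimes>\<^bsub>M2 p\<^esub> B \<in> carrier (M2 p)"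
    by (auto simp: M2_carrier_iff) (auto simp: M2_def)
qed (use assms one_in_M2 in \<open>auto simp: M2_carrier_iff, auto simp: M2_def\<close>)

lemma group_GL2: "p > 1 \<Longrightarrow> group (GL2 p)"
  unfolding GL2_def by (intro monoid.units_group monoid_M2)

lemma group_GL_complex: "group (GL_complex d)"
proof -
  interpret ring "ring_mat TYPE(complex) d ()" by (rule ring_mat)
  show ?thesis unfolding GL_complex_def by (rule units_group)
qed

end

theory Submission
  imports Defs "Jordan_Normal_Form.Spectral_Radius"
begin

text \<open>
  Write \<open>\<psi>\<close> for the additive character of the prime field and
  \<open>G(B) = \<Sum>A. \<psi>(tr(A B)) \<rho>(A)\<close>. Completing the sum over the matrix interval costs a factor
  \<open>O(log p)\<close> per coordinate, so it suffices to show \<open>\<bar>tr G(B)\<bar> \<le> d p\<^sup>2\<close> for every \<open>B\<close>.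
  Since \<open>\<rho>(K) G(B K) = G(B)\<close>, Parseval in an invariant norm bounds the operator norm of \<open>G(B)\<close>
  by \<open>p\<^sup>2\<close> times the square root of the order of the stabiliser of \<open>B\<close>.

  If \<open>B\<close> is invertible, \<open>G(B)\<close> is a multiple of \<open>\<rho>(B)\<^sup>-\<^sup>1\<close> by Schur's lemma and the stabiliser is
  trivial. If \<open>B = 0\<close>, the image of \<open>G(B)\<close> is fixed by the whole group, so \<open>G(B) = 0\<close>. If \<open>B\<close>
  has rank one, the stabiliser \<open>H\<close> is conjugate to the mirabolic subgroup and the image of \<open>G(B)\<close>
  consists of \<open>H\<close>-fixed vectors. These span at most a line, so \<open>tr G(B)\<close> is an eigenvalue of
  \<open>G(B)\<close> and is at most \<open>p\<^sup>3\<close>; and a non-zero \<open>H\<close>-fixed vector forces \<open>d \<ge> p\<close>, because then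
  every \<open>p\<close>-th root of unity is an eigenvalue of a transvection.
\<close>

section \<open>Irreducible representations of finite groups\<close>

lemma mat_trace_mult_comm:
  fixes A B :: "'a :: comm_semiring_0 mat"
  assumes "A \<in> carrier_mat n m" "B \<in> carrier_mat m n"
  shows "mat_trace (A * B) = mat_trace (B * A)"
proof -
  have "mat_trace (A * B) = (\<Sum>i<n. \<Sum>j<m. A $$ (i, j) * B $$ (j, i))"
    using assms by (auto simp: mat_trace_def scalar_prod_def lessThan_atLeast0)
  also have "\<dots> = (\<Sum>j<m. \<Sum>i<n. B $$ (j, i) * A $$ (i, j))"
    by (subst sum.swap) (simp add: mult.commute)
  also have "\<dots> = mat_trace (B * A)"
    using assms by (auto simp: mat_trace_def scalar_prod_def lessThan_atLeast0)
  finally show ?thesis .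
qed

lemma mat_trace_smult:
  fixes A :: "'a :: semiring_0 mat"
  assumes "A \<in> carrier_mat n n"
  shows "mat_trace (k \<cdot>\<^sub>m A) = k * mat_trace A"
  using assms by (simp add: mat_trace_def sum_distrib_left)

text \<open>By Schur decomposition \<open>A\<close> is similar to a triangular matrix whose diagonal
  lists the roots of the characteristic polynomial. Conjugation keeps the trace, which is therefore
  a sum of n eigenvalues.\<close>

lemma cmod_mat_trace_le:
  fixes A :: "complex mat"
  assumes A: "A \<in> carrier_mat n n" and ev: "\<And>e. eigenvalue A e \<Longrightarrow> cmod e \<le> 1"
  shows "cmod (mat_trace A) \<le> real n"
proof -
  obtain es where es: "char_poly A = (\<Prod>e\<leftarrow>es. [:- e, 1:])" "length es = n"
    using char_poly_factorized[OF A] by blast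
  obtain B P Q where "schur_decomposition A es = (B, P, Q)"
    by (cases "schur_decomposition A es")
  from schur_decomposition[OF A es(1) this]
  have sim: "similar_mat_wit A B P Q" and diag: "diag_mat B = es" by auto
  from similar_mat_witD2[OF A sim]
  have B: "B \<in> carrier_mat n n" and P: "P \<in> carrier_mat n n" and Q: "Q \<in> carrier_mat n n"
    and eq: "A = P * B * Q" and QP: "Q * P = 1\<^sub>m n" by auto
  have "mat_trace A = mat_trace (Q * (P * B))"
    unfolding eq using P B Q by (intro mat_trace_mult_comm[of _ n n]) auto
  also have "Q * (P * B) = B"
    using P B Q QP by (simp flip: assoc_mult_mat[of Q n n P n B n])
  finally have tr: "mat_trace A = (\<Sum>i<n. B $$ (i, i))"
    using B by (simp add: mat_trace_def)
  have "cmod (B $$ (i, i)) \<le> 1" if "i < n" for i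
  proof -
    have "B $$ (i, i) = es ! i"
      using B that diag by (auto simp: diag_mat_def)
    then have "B $$ (i, i) \<in> set es" using es(2) that by auto
    then have "poly (char_poly A) (B $$ (i, i)) = 0"
      unfolding es(1) poly_prod_list by (auto simp: prod_list_zero_iff)
    then show ?thesis using ev eigenvalue_root_char_poly[OF A] by blast
  qed
  then have "cmod (mat_trace A) \<le> (\<Sum>i<n. 1 :: real)"
    unfolding tr by (intro sum_norm_le) auto
  then show ?thesis by simp
qed

lemma mat_eqI_vec:
  fixes A B :: "'a :: semiring_1 mat"
  assumes A: "A \<in> carrier_mat n m" and B: "B \<in> carrier_mat n m"
    and eq: "\<And>x. x \<in> carrier_vec m \<Longrightarrow> A *\<^sub>v x = B *\<^sub>v x"
  shows "A = B"
proof (rule eq_matI)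
  fix i j assume ij: "i < dim_row B" "j < dim_col B"
  have *: "M $$ (i, j) = (M *\<^sub>v unit_vec m j) $ i" if "M \<in> carrier_mat n m" for M :: "'a mat"
    using that ij B by auto
  show "A $$ (i, j) = B $$ (i, j)"
    using *[OF A] *[OF B] eq[of "unit_vec m j"] by simp
qed (use A B in auto)

lemma smult_mat_mult_vec:
  fixes A :: "'a :: semiring_0 mat"
  assumes "A \<in> carrier_mat n m" "x \<in> carrier_vec m"
  shows "(k \<cdot>\<^sub>m A) *\<^sub>v x = k \<cdot>\<^sub>v (A *\<^sub>v x)"
  using assms by (intro eq_vecI) (auto simp: scalar_prod_def sum_distrib_left mult.assoc)

lemma mult_vec_index:
  "A \<in> carrier_mat n m \<Longrightarrow> x \<in> carrier_vec m \<Longrightarrow> i < n \<Longrightarrow>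
     (A *\<^sub>v x) $ i = (\<Sum>j<m. A $$ (i, j) * x $ j)"
  by (auto simp: scalar_prod_def lessThan_atLeast0)

definition vec_norm2 :: "complex vec \<Rightarrow> real" where
  "vec_norm2 x = (\<Sum>i<dim_vec x. (cmod (x $ i))\<^sup>2)"

lemma vec_norm2_nonneg: "vec_norm2 x \<ge> 0"
  by (auto simp: vec_norm2_def intro: sum_nonneg)

lemma vec_norm2_pos:
  assumes "x \<in> carrier_vec n" "x \<noteq> 0\<^sub>v n"
  shows "vec_norm2 x > 0"
proof -
  obtain i where i: "i < n" "x $ i \<noteq> 0"
    using assms by (metis carrier_vecD eq_vecI index_zero_vec)
  have "0 < (cmod (x $ i))\<^sup>2" using i by simp
  also have "\<dots> \<le> vec_norm2 x"
    unfolding vec_norm2_def using i assms by (intro member_le_sum) auto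
  finally show ?thesis .
qed

lemma vec_norm2_smult: "vec_norm2 (k \<cdot>\<^sub>v x) = (cmod k)\<^sup>2 * vec_norm2 x"
  by (simp add: vec_norm2_def norm_mult power_mult_distrib sum_distrib_left)

text \<open>Passes from elementary closure conditions to the module-theoretic notion of subspace
  over which \<open>irreducible_representation\<close> quantifies.\<close>

lemma complex_subspaceI:
  assumes "W \<subseteq> carrier_vec d" "0\<^sub>v d \<in> W"
    and "\<And>v w. v \<in> W \<Longrightarrow> w \<in> W \<Longrightarrow> v + w \<in> W"
    and "\<And>k v. v \<in> W \<Longrightarrow> k \<cdot>\<^sub>v v \<in> W"
  shows "VectorSpace.subspace class_ring W (module_vec TYPE(complex) d)"
proof -
  interpret vec_space "TYPE(complex)" d .
  show ?thesis
  proof (rule subspace.intro)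
    show "vectorspace class_ring (module_vec TYPE(complex) d)" by unfold_locales
    show "submodule class_ring W (module_vec TYPE(complex) d)"
      using assms by (intro submodule.intro module_axioms) (auto simp: module_vec_simps)
  qed
qed

section \<open>Group algebra sums, Schur's lemma and cyclic vectors\<close>

locale finite_irrep = group G for G (structure) +
  fixes d :: nat and \<rho> :: "'a \<Rightarrow> complex mat"
  assumes finite_carrier: "finite (carrier G)"
    and irrep: "irreducible_representation G d \<rho>"
begin

lemma d_pos: "d > 0"
  using irrep by (simp add: irreducible_representation_def)

lemma rho_hom: "\<rho> \<in> hom G (GL_complex d)"
  using irrep by (simp add: irreducible_representation_def representation_def)

lemma rho_carrier [simp]: "g \<in> carrier G \<Longrightarrow> \<rho> g \<in> carrier_mat d d"
  using rho_hom by (auto simp: hom_def GL_complex_def units_of_def Units_def ring_mat_def)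

lemma rho_dims [simp]:
  assumes "g \<in> carrier G" shows "dim_row (\<rho> g) = d" "dim_col (\<rho> g) = d"
  using rho_carrier[OF assms] by auto

lemma rho_vec_carrier [simp]:
  "g \<in> carrier G \<Longrightarrow> x \<in> carrier_vec d \<Longrightarrow> \<rho> g *\<^sub>v x \<in> carrier_vec d"
  using mult_mat_vec_carrier rho_carrier by blast

lemma rho_mult: "g \<in> carrier G \<Longrightarrow> h \<in> carrier G \<Longrightarrow> \<rho> (g \<otimes> h) = \<rho> g * \<rho> h"
  using rho_hom by (auto simp: hom_def GL_complex_def units_of_def ring_mat_def)

lemma rho_one: "\<rho> \<one> = 1\<^sub>m d"
proof -
  interpret group_hom G "GL_complex d" \<rho>
    by (intro group_hom.intro group_hom_axioms.intro group_GL_complex rho_hom is_group)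
  show ?thesis using hom_one by (simp add: GL_complex_def units_of_def ring_mat_def)
qed

lemma rho_inv:
  assumes "g \<in> carrier G"
  shows "\<rho> (inv g) * \<rho> g = 1\<^sub>m d" "\<rho> g * \<rho> (inv g) = 1\<^sub>m d"
  using assms by (simp_all flip: rho_mult add: rho_one)

lemma rho_mult_vec:
  assumes "g \<in> carrier G" "h \<in> carrier G" "x \<in> carrier_vec d"
  shows "\<rho> (g \<otimes> h) *\<^sub>v x = \<rho> g *\<^sub>v (\<rho> h *\<^sub>v x)"
  using assms by (simp add: rho_mult assoc_mult_mat_vec[of _ d d _ d])

lemma rho_one_vec [simp]: "x \<in> carrier_vec d \<Longrightarrow> \<rho> \<one> *\<^sub>v x = x"
  by (simp add: rho_one)

text \<open>The action of the group algebra element with coefficients \<open>w\<close>. Gauss sums,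
  averages over a subgroup and isotypic projections all have this form.\<close>

definition rep_sum :: "('a \<Rightarrow> complex) \<Rightarrow> complex mat" where
  "rep_sum w = mat d d (\<lambda>(i, j). \<Sum>g\<in>carrier G. w g * \<rho> g $$ (i, j))"

lemma rep_sum_carrier [simp]: "rep_sum w \<in> carrier_mat d d"
  by (simp add: rep_sum_def)

lemma rep_sum_dims [simp]: "dim_row (rep_sum w) = d" "dim_col (rep_sum w) = d"
  by (simp_all add: rep_sum_def)

lemma rep_sum_vec_carrier [simp]: "rep_sum w *\<^sub>v x \<in> carrier_vec d"
  by (simp add: carrier_vecI)

lemma rep_sum_cong: "(\<And>g. g \<in> carrier G \<Longrightarrow> w g = w' g) \<Longrightarrow> rep_sum w = rep_sum w'"
  by (auto simp: rep_sum_def intro!: sum.cong eq_matI)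

lemma rep_sum_vec_index:
  assumes "x \<in> carrier_vec d" "i < d"
  shows "(rep_sum w *\<^sub>v x) $ i = (\<Sum>g\<in>carrier G. w g * (\<rho> g *\<^sub>v x) $ i)"
proof -
  have "(rep_sum w *\<^sub>v x) $ i = (\<Sum>j<d. \<Sum>g\<in>carrier G. w g * \<rho> g $$ (i, j) * x $ j)"
    using assms by (subst mult_vec_index[of _ d d]) (auto simp: rep_sum_def sum_distrib_right)
  also have "\<dots> = (\<Sum>g\<in>carrier G. \<Sum>j<d. w g * \<rho> g $$ (i, j) * x $ j)"
    by (rule sum.swap)
  also have "\<dots> = (\<Sum>g\<in>carrier G. w g * (\<rho> g *\<^sub>v x) $ i)"
    using assms by (intro sum.cong refl, subst mult_vec_index[of _ d d])
      (auto simp: sum_distrib_left mult.assoc)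
  finally show ?thesis .
qed

lemma mult_rep_sum_vec_index:
  assumes "M \<in> carrier_mat n d" "x \<in> carrier_vec d" "i < n"
  shows "(M *\<^sub>v (rep_sum w *\<^sub>v x)) $ i = (\<Sum>g\<in>carrier G. w g * (M *\<^sub>v (\<rho> g *\<^sub>v x)) $ i)"
proof -
  have "(M *\<^sub>v (rep_sum w *\<^sub>v x)) $ i
      = (\<Sum>j<d. \<Sum>g\<in>carrier G. M $$ (i, j) * (w g * (\<rho> g *\<^sub>v x) $ j))"
    using assms
    by (subst mult_vec_index[of _ n d])
      (auto simp: rep_sum_vec_index sum_distrib_left simp del: index_mult_mat_vec)
  also have "\<dots> = (\<Sum>g\<in>carrier G. \<Sum>j<d. M $$ (i, j) * (w g * (\<rho> g *\<^sub>v x) $ j))"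
    by (rule sum.swap)
  also have "\<dots> = (\<Sum>g\<in>carrier G. w g * (M *\<^sub>v (\<rho> g *\<^sub>v x)) $ i)"
    using assms by (intro sum.cong refl, subst mult_vec_index[of _ n d])
      (auto simp: sum_distrib_left mult_ac simp del: index_mult_mat_vec)
  finally show ?thesis .
qed

text \<open>Reindexing by left translation: multiplying by a group element only translates the
  coefficient function. \<open>rep_sum_mult_rho\<close> is the same on the right.\<close>

lemma rho_mult_rep_sum:
  assumes h: "h \<in> carrier G"
  shows "\<rho> h * rep_sum w = rep_sum (\<lambda>g. w (inv h \<otimes> g))"
proof (rule mat_eqI_vec[of _ d d])
  fix x :: "complex vec" assume x: "x \<in> carrier_vec d"
  have "(\<rho> h *\<^sub>v (rep_sum w *\<^sub>v x)) $ i = (rep_sum (\<lambda>g. w (inv h \<otimes> g)) *\<^sub>v x) $ i"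
    if i: "i < d" for i
  proof -
    have "(\<rho> h *\<^sub>v (rep_sum w *\<^sub>v x)) $ i = (\<Sum>g\<in>carrier G. w g * (\<rho> (h \<otimes> g) *\<^sub>v x) $ i)"
      using h x i
      by (subst mult_rep_sum_vec_index[of _ d])
        (auto simp: rho_mult_vec simp del: index_mult_mat_vec)
    also have "\<dots> = (\<Sum>g\<in>carrier G. w (inv h \<otimes> g) * (\<rho> g *\<^sub>v x) $ i)"
      using h by (intro sum.reindex_bij_witness[of _ "\<lambda>g. inv h \<otimes> g" "\<lambda>g. h \<otimes> g"])
        (auto simp flip: m_assoc)
    also have "\<dots> = (rep_sum (\<lambda>g. w (inv h \<otimes> g)) *\<^sub>v x) $ i"
      using x i by (simp add: rep_sum_vec_index del: index_mult_mat_vec)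
    finally show ?thesis .
  qed
  then have "\<rho> h *\<^sub>v (rep_sum w *\<^sub>v x) = rep_sum (\<lambda>g. w (inv h \<otimes> g)) *\<^sub>v x"
    using h by (intro eq_vecI) auto
  then show "(\<rho> h * rep_sum w) *\<^sub>v x = rep_sum (\<lambda>g. w (inv h \<otimes> g)) *\<^sub>v x"
    using h x by (subst assoc_mult_mat_vec[of _ d d _ d]) auto
qed (use h in auto)

lemma rep_sum_mult_rho:
  assumes h: "h \<in> carrier G"
  shows "rep_sum w * \<rho> h = rep_sum (\<lambda>g. w (g \<otimes> inv h))"
proof (rule mat_eqI_vec[of _ d d])
  fix x :: "complex vec" assume x: "x \<in> carrier_vec d"
  have "(rep_sum w *\<^sub>v (\<rho> h *\<^sub>v x)) $ i = (rep_sum (\<lambda>g. w (g \<otimes> inv h)) *\<^sub>v x) $ i"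
    if i: "i < d" for i
  proof -
    have "(rep_sum w *\<^sub>v (\<rho> h *\<^sub>v x)) $ i = (\<Sum>g\<in>carrier G. w g * (\<rho> (g \<otimes> h) *\<^sub>v x) $ i)"
      using h x i
      by (subst rep_sum_vec_index) (auto simp: rho_mult_vec simp del: index_mult_mat_vec)
    also have "\<dots> = (\<Sum>g\<in>carrier G. w (g \<otimes> inv h) * (\<rho> g *\<^sub>v x) $ i)"
      using h by (intro sum.reindex_bij_witness[of _ "\<lambda>g. g \<otimes> inv h" "\<lambda>g. g \<otimes> h"])
        (auto simp: m_assoc)
    also have "\<dots> = (rep_sum (\<lambda>g. w (g \<otimes> inv h)) *\<^sub>v x) $ i"
      using x i by (simp add: rep_sum_vec_index del: index_mult_mat_vec)
    finally show ?thesis .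
  qed
  then have "rep_sum w *\<^sub>v (\<rho> h *\<^sub>v x) = rep_sum (\<lambda>g. w (g \<otimes> inv h)) *\<^sub>v x"
    by (intro eq_vecI) auto
  then show "(rep_sum w * \<rho> h) *\<^sub>v x = rep_sum (\<lambda>g. w (g \<otimes> inv h)) *\<^sub>v x"
    using h x by (subst assoc_mult_mat_vec[of _ d d _ d]) auto
qed (use h in auto)

lemma mat_trace_rep_sum: "mat_trace (rep_sum w) = (\<Sum>g\<in>carrier G. w g * mat_trace (\<rho> g))"
proof -
  have "mat_trace (rep_sum w) = (\<Sum>i<d. \<Sum>g\<in>carrier G. w g * \<rho> g $$ (i, i))"
    by (simp add: mat_trace_def rep_sum_def)
  also have "\<dots> = (\<Sum>g\<in>carrier G. \<Sum>i<d. w g * \<rho> g $$ (i, i))"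
    by (rule sum.swap)
  also have "\<dots> = (\<Sum>g\<in>carrier G. w g * mat_trace (\<rho> g))"
    by (intro sum.cong refl) (auto simp: mat_trace_def sum_distrib_left)
  finally show ?thesis .
qed

text \<open>Irreducibility with the subspace axioms unpacked, so that each application only exhibits
  an invariant set and one non-zero vector in it.\<close>

lemma invariant_subspace:
  assumes "W \<subseteq> carrier_vec d" "0\<^sub>v d \<in> W"
    and "\<And>v w. v \<in> W \<Longrightarrow> w \<in> W \<Longrightarrow> v + w \<in> W"
    and "\<And>k v. v \<in> W \<Longrightarrow> k \<cdot>\<^sub>v v \<in> W"
    and "\<And>g v. g \<in> carrier G \<Longrightarrow> v \<in> W \<Longrightarrow> \<rho> g *\<^sub>v v \<in> W"
    and "v \<in> W" "v \<noteq> 0\<^sub>v d"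
  shows "W = carrier_vec d"
  using irrep complex_subspaceI[OF assms(1-4)] assms(5-)
  unfolding irreducible_representation_def by blast

text \<open>\<open>S\<close> has an eigenvalue because the field is algebraically closed and
  \<open>d > 0\<close>. Its eigenspace is invariant, since \<open>S\<close> commutes with the
  representation, and so is the whole space.\<close>

lemma schur:
  assumes S: "S \<in> carrier_mat d d" and comm: "\<And>g. g \<in> carrier G \<Longrightarrow> \<rho> g * S = S * \<rho> g"
  shows "\<exists>k. S = k \<cdot>\<^sub>m 1\<^sub>m d"
proof -
  obtain k v where "eigenvector S v k"
    using spectrum_non_empty[OF S d_pos] by (auto simp: spectrum_def eigenvalue_def)
  then have v: "v \<in> carrier_vec d" "v \<noteq> 0\<^sub>v d" "S *\<^sub>v v = k \<cdot>\<^sub>v v"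
    using S by (auto simp: eigenvector_def)
  have "{x \<in> carrier_vec d. S *\<^sub>v x = k \<cdot>\<^sub>v x} = carrier_vec d"
  proof (rule invariant_subspace)
    fix g x assume g: "g \<in> carrier G" and "x \<in> {x \<in> carrier_vec d. S *\<^sub>v x = k \<cdot>\<^sub>v x}"
    then have x: "x \<in> carrier_vec d" "S *\<^sub>v x = k \<cdot>\<^sub>v x" by auto
    have "S *\<^sub>v (\<rho> g *\<^sub>v x) = (\<rho> g * S) *\<^sub>v x"
      using S g x comm by (simp add: assoc_mult_mat_vec[of _ d d _ d])
    also have "\<dots> = k \<cdot>\<^sub>v (\<rho> g *\<^sub>v x)"
      using S g x by (simp add: assoc_mult_mat_vec[of _ d d _ d] mult_mat_vec[of _ d d])
    finally show "\<rho> g *\<^sub>v x \<in> {x \<in> carrier_vec d. S *\<^sub>v x = k \<cdot>\<^sub>v x}"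
      using g x by simp
  next
    show "v \<in> {x \<in> carrier_vec d. S *\<^sub>v x = k \<cdot>\<^sub>v x}" using v by simp
  next
    fix k' x assume "x \<in> {x \<in> carrier_vec d. S *\<^sub>v x = k \<cdot>\<^sub>v x}"
    then show "k' \<cdot>\<^sub>v x \<in> {x \<in> carrier_vec d. S *\<^sub>v x = k \<cdot>\<^sub>v x}"
      using S by (simp add: mult_mat_vec[of _ d d] smult_smult_assoc mult.commute)
  next
    show "0\<^sub>v d \<in> {x \<in> carrier_vec d. S *\<^sub>v x = k \<cdot>\<^sub>v x}"
      using S by auto
  qed (use S v in \<open>auto simp: mult_add_distrib_mat_vec[of _ d d] smult_add_distrib_vec[of _ d]\<close>)
  then have "S = k \<cdot>\<^sub>m 1\<^sub>m d"
    using S by (intro mat_eqI_vec[of _ d d]) (auto simp: smult_mat_mult_vec[of _ d d])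
  then show ?thesis ..
qed

lemma rep_sum_add_vec:
  assumes "x \<in> carrier_vec d"
  shows "rep_sum w *\<^sub>v x + rep_sum w' *\<^sub>v x = rep_sum (\<lambda>g. w g + w' g) *\<^sub>v x"
  using assms by (intro eq_vecI)
    (auto simp: rep_sum_vec_index ring_distribs sum.distrib simp del: index_mult_mat_vec)

lemma rep_sum_smult_vec:
  assumes "x \<in> carrier_vec d"
  shows "k \<cdot>\<^sub>v (rep_sum w *\<^sub>v x) = rep_sum (\<lambda>g. k * w g) *\<^sub>v x"
  using assms by (intro eq_vecI)
    (auto simp: rep_sum_vec_index sum_distrib_left mult.assoc simp del: index_mult_mat_vec)

text \<open>The orbit of \<open>v\<close> under the group algebra is an invariant subspace
  containing \<open>v\<close>.\<close>

lemma cyclic: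
  assumes v: "v \<in> carrier_vec d" "v \<noteq> 0\<^sub>v d" and x: "x \<in> carrier_vec d"
  shows "\<exists>w. x = rep_sum w *\<^sub>v v"
proof -
  have "range (\<lambda>w. rep_sum w *\<^sub>v v) = carrier_vec d"
  proof (rule invariant_subspace)
    have "0\<^sub>v d = rep_sum (\<lambda>_. 0) *\<^sub>v v"
      using v by (intro eq_vecI) (auto simp: rep_sum_vec_index simp del: index_mult_mat_vec)
    then show "0\<^sub>v d \<in> range (\<lambda>w. rep_sum w *\<^sub>v v)" by blast
    \<comment> \<open>The indicator function of the identity element acts as the identity
      operator.\<close>
    have "v = rep_sum (\<lambda>g. if g = \<one> then 1 else 0) *\<^sub>v v"
      using v finite_carrier
      by (intro eq_vecI)
        (auto simp: rep_sum_vec_index sum.delta if_distrib[of "\<lambda>x. x * _"] rho_one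
          simp del: index_mult_mat_vec cong: if_cong)
    then show "v \<in> range (\<lambda>w. rep_sum w *\<^sub>v v)" by blast
  next
    fix g u assume "g \<in> carrier G" "u \<in> range (\<lambda>w. rep_sum w *\<^sub>v v)"
    then show "\<rho> g *\<^sub>v u \<in> range (\<lambda>w. rep_sum w *\<^sub>v v)"
      using v by (auto simp: rho_mult_rep_sum simp flip: assoc_mult_mat_vec[of _ d d _ d])
  qed (use v in \<open>auto simp: rep_sum_add_vec rep_sum_smult_vec\<close>)
  with x show ?thesis by blast
qed

text \<open>The vectors fixed by the whole group form an invariant subspace.\<close>

lemma fixed_vector_imp_trivial:
  assumes v: "v \<in> carrier_vec d" "v \<noteq> 0\<^sub>v d" and fixed: "\<And>g. g \<in> carrier G \<Longrightarrow> \<rho> g *\<^sub>v v = v"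
  shows "trivial_representation G d \<rho>"
  unfolding trivial_representation_def
proof
  fix h assume h: "h \<in> carrier G"
  have "{x \<in> carrier_vec d. \<forall>g\<in>carrier G. \<rho> g *\<^sub>v x = x} = carrier_vec d"
    by (rule invariant_subspace[of _ v])
      (use v fixed in \<open>auto simp: mult_add_distrib_mat_vec[of _ d d] mult_mat_vec[of _ d d]\<close>)
  then show "\<rho> h = 1\<^sub>m d"
    using h by (intro mat_eqI_vec[of _ d d]) auto
qed

section \<open>A norm invariant under the group\<close>

text \<open>Weyl's averaging, applied directly to the squared norm. This gives the benefit of a
  unitary representation without choosing an inner product or a new basis.\<close>

definition inv_norm2 :: "complex vec \<Rightarrow> real" where
  "inv_norm2 x = (\<Sum>g\<in>carrier G. vec_norm2 (\<rho> g *\<^sub>v x))"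

lemma inv_norm2_nonneg: "inv_norm2 x \<ge> 0"
  by (auto simp: inv_norm2_def intro: sum_nonneg vec_norm2_nonneg)

lemma inv_norm2_pos:
  assumes "x \<in> carrier_vec d" "x \<noteq> 0\<^sub>v d"
  shows "inv_norm2 x > 0"
proof -
  have "0 < vec_norm2 (\<rho> \<one> *\<^sub>v x)" using assms by (simp add: vec_norm2_pos)
  also have "\<dots> \<le> inv_norm2 x"
    unfolding inv_norm2_def using finite_carrier
    by (intro member_le_sum) (auto intro: vec_norm2_nonneg)
  finally show ?thesis .
qed

lemma inv_norm2_smult: "x \<in> carrier_vec d \<Longrightarrow> inv_norm2 (k \<cdot>\<^sub>v x) = (cmod k)\<^sup>2 * inv_norm2 x"
  by (auto simp: inv_norm2_def mult_mat_vec[of _ d d] vec_norm2_smult sum_distrib_left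
      intro!: sum.cong)

lemma inv_norm2_rho:
  assumes "h \<in> carrier G" "x \<in> carrier_vec d"
  shows "inv_norm2 (\<rho> h *\<^sub>v x) = inv_norm2 x"
proof -
  have "inv_norm2 (\<rho> h *\<^sub>v x) = (\<Sum>g\<in>carrier G. vec_norm2 (\<rho> (g \<otimes> h) *\<^sub>v x))"
    using assms by (simp add: inv_norm2_def rho_mult_vec)
  also have "\<dots> = inv_norm2 x"
    unfolding inv_norm2_def using assms
    by (intro sum.reindex_bij_witness[of _ "\<lambda>g. g \<otimes> inv h" "\<lambda>g. g \<otimes> h"]) (auto simp: m_assoc)
  finally show ?thesis .
qed

text \<open>An eigenvector keeps its invariant norm under \<open>\<rho> g\<close>, so every
  eigenvalue has modulus 1.\<close>

lemma cmod_character_le: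
  assumes g: "g \<in> carrier G"
  shows "cmod (mat_trace (\<rho> g)) \<le> real d"
proof (rule cmod_mat_trace_le)
  fix e assume "eigenvalue (\<rho> g) e"
  then obtain x where x: "x \<in> carrier_vec d" "x \<noteq> 0\<^sub>v d" "\<rho> g *\<^sub>v x = e \<cdot>\<^sub>v x"
    using g by (auto simp: eigenvalue_def eigenvector_def)
  then have "(cmod e)\<^sup>2 * inv_norm2 x = inv_norm2 x"
    using inv_norm2_rho[OF g x(1)] by (simp add: inv_norm2_smult)
  then have "(cmod e)\<^sup>2 = 1" using inv_norm2_pos[OF x(1,2)] by simp
  then show "cmod e \<le> 1" by (auto simp: power2_eq_1_iff)
qed (use g in simp)

end

section \<open>Additive characters and completion of sums\<close>

text \<open>Jordan's inequality, by concavity. The difference \<open>f\<close> of the sine and its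
  chord vanishes at 0 and pi/2. If it were negative at t, the mean value theorem would give it a
  negative slope before t and a positive slope after t, although the cosine decreases.\<close>

lemma sin_ge_two_div_pi:
  fixes t :: real
  assumes "0 \<le> t" "t \<le> pi / 2"
  shows "2 * t / pi \<le> sin t"
proof (cases "t = 0 \<or> t = pi / 2")
  case True
  then show ?thesis by (elim disjE, simp) (simp only:, simp)
next
  case False
  with assms have t: "0 < t" "t < pi / 2" by auto
  define f where "f = (\<lambda>t. sin t - 2 * t / pi)"
  have deriv: "(f has_real_derivative cos x - 2 / pi) (at x)" for x
    unfolding f_def by (auto intro!: derivative_eq_intros)
  obtain a where a: "0 < a" "a < t" "f t - f 0 = (t - 0) * (cos a - 2 / pi)"
    using MVT2[of 0 t f "\<lambda>x. cos x - 2 / pi"] t deriv by blast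
  obtain b where b: "t < b" "b < pi / 2" "f (pi / 2) - f t = (pi / 2 - t) * (cos b - 2 / pi)"
    using MVT2[of t "pi / 2" f "\<lambda>x. cos x - 2 / pi"] t deriv by blast
  show ?thesis
  proof (rule ccontr)
    assume "\<not> ?thesis"
    then have neg: "f t < 0" by (simp add: f_def)
    have "cos a - 2 / pi < 0"
      using a neg t by (simp add: f_def mult_less_0_iff)
    moreover have "0 < cos b - 2 / pi"
    proof -
      have "0 < f (pi / 2) - f t" using neg by (simp add: f_def)
      then show ?thesis unfolding b(3) using t by (simp add: zero_less_mult_iff)
    qed
    moreover have "cos b < cos a"
      using a b by (intro cos_monotone_0_pi) auto
    ultimately show False by linarith
  qed
qed

section \<open>The additive character and its sums over an interval\<close>

text \<open>Taken on the integers rather than on residues, so that it applies at once to entries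
  from an interval; \<open>add_char_cong\<close> supplies the periodicity.\<close>

definition add_char :: "nat \<Rightarrow> int \<Rightarrow> complex" where
  "add_char p x = cis (2 * pi * real_of_int x / real p)"

lemma add_char_0 [simp]: "add_char p 0 = 1"
  by (simp add: add_char_def)

lemma add_char_add: "add_char p (x + y) = add_char p x * add_char p y"
  by (simp add: add_char_def cis_mult add_divide_distrib ring_distribs)

lemma add_char_minus: "add_char p (- x) = cnj (add_char p x)"
  by (simp add: add_char_def cis_cnj)

lemma add_char_diff: "add_char p (x - y) = add_char p x * cnj (add_char p y)"
  using add_char_add[of p x "- y"] by (simp add: add_char_minus)

lemma norm_add_char [simp]: "cmod (add_char p x) = 1"
  by (simp add: add_char_def)

lemma add_char_power: "add_char p x ^ n = add_char p (x * int n)"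
  by (simp add: add_char_def DeMoivre mult_ac)

lemma add_char_mod:
  assumes "p > 0"
  shows "add_char p (x mod int p) = add_char p x"
proof -
  have "add_char p (int p * k) = 1" for k
    using assms cis_multiple_2pi[of "real_of_int k"] by (simp add: add_char_def mult_ac)
  then show ?thesis
    by (metis add_char_add mult_1 mult_div_mod_eq)
qed

lemma add_char_cong:
  assumes "p > 0" "[x = y] (mod int p)"
  shows "add_char p x = add_char p y"
  using assms by (metis add_char_mod cong_def)

lemma add_char_eq_1_iff:
  assumes "p > 0"
  shows "add_char p x = 1 \<longleftrightarrow> int p dvd x"
proof
  assume "add_char p x = 1"
  then have "cos (2 * pi * real_of_int x / real p) = 1"
    by (simp add: add_char_def complex_eq_iff)
  then obtain n :: int where "2 * pi * real_of_int x / real p = real_of_int n * 2 * pi"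
    by (auto simp: cos_one_2pi_int)
  then have "real_of_int x = real_of_int (n * int p)"
    using assms by (simp add: field_simps)
  then have "x = n * int p" by (simp only: of_int_eq_iff)
  then show "int p dvd x" by simp
next
  assume "int p dvd x"
  then have "[x = 0] (mod int p)" by (simp add: cong_0_iff)
  then show "add_char p x = 1" using assms add_char_cong by fastforce
qed

lemma sum_int_interval: "(\<Sum>b\<in>{0..<int n}. f b) = (\<Sum>b<n. f (int b))"
  by (rule sum.reindex_bij_witness[of _ int nat]) auto

text \<open>A geometric sum whose ratio is a p-th root of unity, equal to 1 exactly when p divides
  x.\<close>

lemma add_char_orthogonality:
  assumes "p > 0"
  shows "(\<Sum>b\<in>{0..<int p}. add_char p (x * b)) = (if int p dvd x then of_nat p else 0)"
proof -
  have eq: "(\<Sum>b\<in>{0..<int p}. add_char p (x * b)) = (\<Sum>b<p. add_char p x ^ b)"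
    by (simp add: sum_int_interval add_char_power)
  show ?thesis
  proof (cases "int p dvd x")
    case True
    then have "add_char p x = 1" using assms by (simp add: add_char_eq_1_iff)
    then show ?thesis using True eq by simp
  next
    case False
    moreover have "add_char p x ^ p = 1"
      unfolding add_char_power using assms by (simp add: add_char_eq_1_iff)
    ultimately show ?thesis
      using eq assms by (simp add: geometric_sum add_char_eq_1_iff)
  qed
qed

lemma norm_one_minus_cis: "cmod (1 - cis t) = 2 * \<bar>sin (t / 2)\<bar>"
proof -
  have "cos t = 1 - 2 * (sin (t / 2))\<^sup>2"
    using cos_double_sin[of "t / 2"] by simp
  moreover have "(cmod (1 - cis t))\<^sup>2 = 2 - 2 * cos t"
    using sin_cos_squared_add[of t]
    unfolding cmod_power2 by (simp add: power2_eq_square algebra_simps)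
  ultimately have "(cmod (1 - cis t))\<^sup>2 = (2 * \<bar>sin (t / 2)\<bar>)\<^sup>2"
    by (simp add: power_mult_distrib)
  then show ?thesis by (rule power2_eq_imp_eq) auto
qed

text \<open>The geometric sum is at most 2 / |1 - z| = 1 / |sin (pi b / p)|. Jordan's inequality
  bounds this by p / (2 b) in the first half of the range and by p / (2 (p - b)) in the second. The
  sum of both terms dominates either one and is easy to sum over b.\<close>

lemma norm_geometric_add_char_le:
  assumes p: "p > 0" and b: "0 < b" "b < int p"
  shows "cmod (\<Sum>n\<in>{u..v}. add_char p (n * b))
           \<le> real p / (2 * real_of_int b) + real p / (2 * (real p - real_of_int b))"
proof (cases "u \<le> v")
  case False
  then show ?thesis using b by simp
next
  case True
  define z where "z = add_char p b"
  define N where "N = nat (v - u + 1)"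
  have z1: "z \<noteq> 1"
    using p b zdvd_imp_le[of "int p" b] by (auto simp: z_def add_char_eq_1_iff)
  have "(\<Sum>n\<in>{u..v}. add_char p (n * b)) = (\<Sum>k<N. add_char p (u * b) * z ^ k)"
    by (rule sum.reindex_bij_witness[of _ "\<lambda>k. u + int k" "\<lambda>n. nat (n - u)"])
      (use True in \<open>auto simp: N_def z_def add_char_power simp flip: add_char_add,
        simp_all add: algebra_simps\<close>)
  also have "\<dots> = add_char p (u * b) * ((1 - z ^ N) / (1 - z))"
    using z1 by (simp add: sum_gp_strict flip: sum_distrib_left)
  finally have "cmod (\<Sum>n\<in>{u..v}. add_char p (n * b)) = cmod (1 - z ^ N) / cmod (1 - z)"
    by (simp add: norm_mult norm_divide)
  also have "cmod (1 - z ^ N) \<le> 2"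
    using norm_triangle_ineq4[of 1 "z ^ N"] by (simp add: z_def add_char_power)
  then have "cmod (1 - z ^ N) / cmod (1 - z) \<le> 2 / cmod (1 - z)"
    by (intro divide_right_mono) auto
  also have "cmod (1 - z) = 2 * \<bar>sin (pi * real_of_int b / real p)\<bar>"
    by (simp add: z_def add_char_def norm_one_minus_cis)
  also have "2 / (2 * \<bar>sin (pi * real_of_int b / real p)\<bar>)
      \<le> real p / (2 * real_of_int b) + real p / (2 * (real p - real_of_int b))"
  proof -
    have b': "0 < real_of_int b" "real_of_int b < real p" using b by linarith+
    define t where "t = pi * real_of_int b / real p"
    have t: "0 < t" "t < pi" using b' by (auto simp: t_def field_simps)
    show ?thesis
    proof (cases "t \<le> pi / 2")
      case True
      have "0 < 2 * t / pi" using t by simp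
      also have le: "2 * t / pi \<le> \<bar>sin t\<bar>"
        using sin_ge_two_div_pi[of t] True t by linarith
      finally have "2 / (2 * \<bar>sin t\<bar>) \<le> 1 / (2 * t / pi)"
        using frac_le[of 1 1 "2 * t / pi" "\<bar>sin t\<bar>"] le t by simp
      also have "\<dots> = real p / (2 * real_of_int b)"
        using b' p by (simp add: t_def)
      also have "\<dots> \<le> real p / (2 * real_of_int b) + real p / (2 * (real p - real_of_int b))"
        using b' by simp
      finally show ?thesis by (simp add: t_def)
    next
      case False
      have "0 < 2 * (pi - t) / pi" using t by simp
      also have le: "2 * (pi - t) / pi \<le> \<bar>sin t\<bar>"
        using sin_ge_two_div_pi[of "pi - t"] False t by simp
      finally have "2 / (2 * \<bar>sin t\<bar>) \<le> 1 / (2 * (pi - t) / pi)"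
        using frac_le[of 1 1 "2 * (pi - t) / pi" "\<bar>sin t\<bar>"] le t by simp
      also have "\<dots> = real p / (2 * (real p - real_of_int b))"
        using b' p by (simp add: t_def field_simps)
      also have "\<dots> \<le> real p / (2 * real_of_int b) + real p / (2 * (real p - real_of_int b))"
        using b' by simp
      finally show ?thesis by (simp add: t_def)
    qed
  qed
  finally show ?thesis .
qed

lemma harmonic_le_one_plus_ln:
  assumes "n > 0"
  shows "(\<Sum>k=1..n. 1 / real k) \<le> 1 + ln (real n)"
  using assms
proof (induction n rule: nat_induct_non_zero)
  case (Suc n)
  \<comment> \<open>The inequality ln x \<le> x - 1 at x = n / (n + 1) shows that ln grows by at
    least 1 / (n + 1) from n to n + 1.\<close>
  have "ln (real n / real (Suc n)) \<le> real n / real (Suc n) - 1"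
    using Suc by (intro ln_le_minus_one) auto
  moreover have "ln (real n / real (Suc n)) = ln (real n) - ln (real (Suc n))"
    using Suc by (simp add: ln_div)
  moreover have "real n / real (Suc n) - 1 = - (1 / real (Suc n))"
    by (simp add: field_simps)
  ultimately show ?case using Suc by simp
qed simp

text \<open>Frequency 0 contributes the length of the interval. At the other frequencies the two
  terms of the pointwise bound give the same harmonic sum after b is replaced by p - b.\<close>

lemma sum_norm_geometric_add_char_le:
  assumes p: "p > 1"
  shows "(\<Sum>b\<in>{0..<int p}. cmod (\<Sum>n\<in>{u..v}. add_char p (n * b)))
           \<le> real (card {u..v}) + real p * (1 + ln (real p))"
proof -
  define D where "D b = cmod (\<Sum>n\<in>{u..v}. add_char p (n * b))" for b
  have "(\<Sum>b\<in>{0..<int p}. D b) = (\<Sum>b<p. D (int b))"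
    by (rule sum_int_interval)
  also have "\<dots> = D 0 + (\<Sum>b=1..p-1. D (int b))"
  proof -
    have "{..<p} = insert 0 {1..p-1}" using p by auto
    then show ?thesis by simp
  qed
  also have "D 0 = real (card {u..v})" by (simp add: D_def)
  also have "(\<Sum>b=1..p-1. D (int b))
      \<le> (\<Sum>b=1..p-1. real p / 2 * (1 / real b) + real p / 2 * (1 / real (p - b)))"
  proof (rule sum_mono)
    fix b assume "b \<in> {1..p-1}"
    then have b: "0 < int b" "int b < int p" by auto
    show "D (int b) \<le> real p / 2 * (1 / real b) + real p / 2 * (1 / real (p - b))"
      using norm_geometric_add_char_le[of p "int b" u v] b p by (simp add: D_def of_nat_diff)
  qed
  also have "\<dots> = real p / 2 * (\<Sum>b=1..p-1. 1 / real b) + real p / 2 * (\<Sum>b=1..p-1. 1 / real (p - b))"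
    by (simp only: sum.distrib sum_distrib_left)
  also have "(\<Sum>b=1..p-1. 1 / real (p - b)) = (\<Sum>b=1..p-1. 1 / real b)"
    by (rule sum.reindex_bij_witness[of _ "\<lambda>b. p - b" "\<lambda>b. p - b"]) auto
  also have "real p / 2 * (\<Sum>b=1..p-1. 1 / real b) + real p / 2 * (\<Sum>b=1..p-1. 1 / real b)
      = real p * (\<Sum>b=1..p-1. 1 / real b)"
    by simp
  also have "(\<Sum>b=1..p-1. 1 / real b) \<le> 1 + ln (real (p - 1))"
    using p by (intro harmonic_le_one_plus_ln) auto
  also have "ln (real (p - 1)) \<le> ln (real p)"
    using p by simp
  finally show ?thesis using p by (simp add: D_def)
qed

section \<open>Two by two integer matrices through their entries\<close>

definition m22 :: "int \<Rightarrow> int \<Rightarrow> int \<Rightarrow> int \<Rightarrow> int mat" where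
  "m22 a b c e = mat 2 2 (\<lambda>(i, j). if i = 0 then if j = 0 then a else b else if j = 0 then c else e)"

lemma m22_carrier [simp]: "m22 a b c e \<in> carrier_mat 2 2"
  by (simp add: m22_def)

lemma m22_dims [simp]: "dim_row (m22 a b c e) = 2" "dim_col (m22 a b c e) = 2"
  by (simp_all add: m22_def)

lemma m22_index [simp]:
  "m22 a b c e $$ (0, 0) = a" "m22 a b c e $$ (0, Suc 0) = b"
  "m22 a b c e $$ (Suc 0, 0) = c" "m22 a b c e $$ (Suc 0, Suc 0) = e"
  by (simp_all add: m22_def)

lemma all_less_2: "(\<forall>i<(2::nat). P i) \<longleftrightarrow> P 0 \<and> P (Suc 0)"
  by (auto simp: less_2_cases_iff)

lemma carrier_mat_2_eq_m22:
  assumes "A \<in> carrier_mat 2 2"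
  shows "A = m22 (A $$ (0, 0)) (A $$ (0, Suc 0)) (A $$ (Suc 0, 0)) (A $$ (Suc 0, Suc 0))"
  using assms by (intro eq_matI) (auto simp: less_2_cases_iff)

lemma m22_eq_iff [simp]: "m22 a b c e = m22 a' b' c' e' \<longleftrightarrow> a = a' \<and> b = b' \<and> c = c' \<and> e = e'"
  by (metis m22_index)

lemma m22_mult:
  "m22 a b c e * m22 a' b' c' e'
     = m22 (a * a' + b * c') (a * b' + b * e') (c * a' + e * c') (c * b' + e * e')"
  by (intro eq_matI) (auto simp: less_2_cases_iff scalar_prod_def sum.atLeast_Suc_lessThan)

lemma mat_trace_m22: "mat_trace (m22 a b c e) = a + e"
  by (simp add: mat_trace_def numeral_2_eq_2)

lemma mat_mod_m22:
  "mat_mod p (m22 a b c e) = m22 (a mod int p) (b mod int p) (c mod int p) (e mod int p)"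
  unfolding mat_mod_def by (intro eq_matI) (auto simp: less_2_cases_iff)

lemma matrix_interval_eq_image:
  "matrix_interval I
     = (\<lambda>(a, b, c, e). m22 a b c e) ` (I 0 0 \<times> I 0 (Suc 0) \<times> I (Suc 0) 0 \<times> I (Suc 0) (Suc 0))"
proof safe
  fix A assume A: "A \<in> matrix_interval I"
  then have "A = m22 (A $$ (0, 0)) (A $$ (0, Suc 0)) (A $$ (Suc 0, 0)) (A $$ (Suc 0, Suc 0))"
    by (intro carrier_mat_2_eq_m22) (simp add: matrix_interval_def)
  moreover have "(A $$ (0, 0), A $$ (0, Suc 0), A $$ (Suc 0, 0), A $$ (Suc 0, Suc 0))
      \<in> I 0 0 \<times> I 0 (Suc 0) \<times> I (Suc 0) 0 \<times> I (Suc 0) (Suc 0)"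
    using A by (simp add: matrix_interval_def)
  ultimately show "A \<in> (\<lambda>(a, b, c, e). m22 a b c e)
      ` (I 0 0 \<times> I 0 (Suc 0) \<times> I (Suc 0) 0 \<times> I (Suc 0) (Suc 0))"
    by (intro image_eqI[where x = "(A $$ (0, 0), A $$ (0, Suc 0), A $$ (Suc 0, 0), A $$ (Suc 0, Suc 0))"])
      simp_all
qed (auto simp: matrix_interval_def all_less_2)

lemma sum_matrix_interval:
  "(\<Sum>A\<in>matrix_interval I. f A)
     = (\<Sum>a\<in>I 0 0. \<Sum>b\<in>I 0 (Suc 0). \<Sum>c\<in>I (Suc 0) 0. \<Sum>e\<in>I (Suc 0) (Suc 0). f (m22 a b c e))"
proof -
  have "inj_on (\<lambda>(a, b, c, e). m22 a b c e) X" for X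
    by (auto simp: inj_on_def)
  then show ?thesis
    unfolding matrix_interval_eq_image
    by (simp add: sum.reindex sum.cartesian_product case_prod_unfold)
qed

lemma sum_prod4:
  fixes f1 f2 f3 f4 :: "'a \<Rightarrow> 'b :: comm_semiring_0"
  shows "(\<Sum>a\<in>A. \<Sum>b\<in>B. \<Sum>c\<in>C. \<Sum>e\<in>E. f1 a * f2 b * f3 c * f4 e)
           = sum f1 A * sum f2 B * sum f3 C * sum f4 E"
  by (simp flip: sum_distrib_left sum_distrib_right)

text \<open>The full set of residue matrices is itself a matrix interval, so
  \<open>sum_matrix_interval\<close> serves both the physical and the frequency side.\<close>

lemma carrier_M2: "carrier (M2 p) = matrix_interval (\<lambda>_ _. {0..<int p})"
proof -
  have "A \<in> carrier (M2 p) \<longleftrightarrow> A \<in> matrix_interval (\<lambda>_ _. {0..<int p})" for A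
    unfolding M2_def matrix_interval_def residue_ring_def
    by (fastforce simp: elements_mat_def)
  then show ?thesis by blast
qed

lemma M2_mult: "A \<otimes>\<^bsub>M2 p\<^esub> B = mat_mod p (A * B)"
  by (simp add: M2_def)

lemma M2_one: "\<one>\<^bsub>M2 p\<^esub> = 1\<^sub>m 2"
  by (simp add: M2_def)

section \<open>Fourier analysis on matrices modulo p\<close>

text \<open>The Fourier kernel \<psi>(tr(A B)). The trace form is non-degenerate, so these are all
  the additive characters of the matrix ring as B varies.\<close>

definition phase :: "nat \<Rightarrow> int mat \<Rightarrow> int mat \<Rightarrow> complex" where
  "phase p A B = add_char p (mat_trace (A * B))"

lemma phase_m22:
  "phase p (m22 a b c e) (m22 a' b' c' e') = add_char p (a * a' + b * c' + c * b' + e * e')"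
  by (simp add: phase_def m22_mult mat_trace_m22 add_ac)

text \<open>The trace form pairs the off-diagonal entries crosswise. The factors are listed in the
  order of the entries of the second matrix, over which sums are taken.\<close>

lemma phase_m22_split:
  "phase p (m22 a b c e) (m22 a' b' c' e')
     = add_char p (a * a') * add_char p (c * b') * add_char p (b * c') * add_char p (e * e')"
  by (simp add: phase_m22 add_char_add mult_ac)

lemma phase_mat_mod_left:
  assumes "p > 0" "A \<in> carrier_mat 2 2" "B \<in> carrier_mat 2 2"
  shows "phase p (mat_mod p A) B = phase p A B"
proof -
  obtain a b c e a' b' c' e' where "A = m22 a b c e" "B = m22 a' b' c' e'"
    using assms carrier_mat_2_eq_m22 by metis
  then show ?thesis
    using assms by (auto simp: mat_mod_m22 phase_m22 intro!: add_char_cong cong_add cong_mult)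
qed

lemma phase_commute:
  assumes "A \<in> carrier_mat 2 2" "B \<in> carrier_mat 2 2"
  shows "phase p A B = phase p B A"
  unfolding phase_def using assms by (simp add: mat_trace_mult_comm)

lemma phase_mat_mod_right:
  assumes "p > 0" "A \<in> carrier_mat 2 2" "B \<in> carrier_mat 2 2"
  shows "phase p A (mat_mod p B) = phase p A B"
  using assms phase_mat_mod_left[of p B A] by (simp add: phase_commute[of A])

text \<open>Cyclic invariance of the trace: a factor of the frequency can be moved to the argument,
  where a sum over the group absorbs it.\<close>

lemma phase_assoc:
  assumes "p > 0" "A \<in> carrier_mat 2 2" "B \<in> carrier_mat 2 2" "K \<in> carrier_mat 2 2"
  shows "phase p A (B \<otimes>\<^bsub>M2 p\<^esub> K) = phase p (K \<otimes>\<^bsub>M2 p\<^esub> A) B"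
    and "phase p A (K \<otimes>\<^bsub>M2 p\<^esub> B) = phase p (A \<otimes>\<^bsub>M2 p\<^esub> K) B"
proof -
  have 1: "phase p A (B * K) = phase p (K * A) B"
    unfolding phase_def
    using assms mat_trace_mult_comm[of "A * B" 2 2 K] by (simp add: assoc_mult_mat[of _ 2 2 _ 2 _ 2])
  have 2: "phase p A (K * B) = phase p (A * K) B"
    unfolding phase_def using assms by (simp add: assoc_mult_mat[of _ 2 2 _ 2 _ 2])
  show "phase p A (B \<otimes>\<^bsub>M2 p\<^esub> K) = phase p (K \<otimes>\<^bsub>M2 p\<^esub> A) B"
    unfolding M2_mult using assms 1 by (simp add: phase_mat_mod_left phase_mat_mod_right)
  show "phase p A (K \<otimes>\<^bsub>M2 p\<^esub> B) = phase p (A \<otimes>\<^bsub>M2 p\<^esub> K) B"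
    unfolding M2_mult using assms 2 by (simp add: phase_mat_mod_left phase_mat_mod_right)
qed

text \<open>The sum factors into four one-dimensional orthogonality relations, one for each
  entry.\<close>

lemma phase_orthogonality:
  assumes p: "p > 0" and A: "A \<in> carrier_mat 2 2" and A': "A' \<in> carrier_mat 2 2"
  shows "(\<Sum>B\<in>carrier (M2 p). phase p A B * cnj (phase p A' B))
           = (if mat_mod p A = mat_mod p A' then of_nat p ^ 4 else 0)"
proof -
  obtain a b c e a' b' c' e' where eq: "A = m22 a b c e" "A' = m22 a' b' c' e'"
    using A A' carrier_mat_2_eq_m22 by metis
  let ?S = "\<lambda>x. (\<Sum>t\<in>{0..<int p}. add_char p (x * t))"
  have "(\<Sum>B\<in>carrier (M2 p). phase p A B * cnj (phase p A' B))
      = ?S (a - a') * ?S (c - c') * ?S (b - b') * ?S (e - e')"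
    unfolding carrier_M2 sum_matrix_interval eq phase_m22_split
    by (subst sum_prod4[symmetric]) (simp add: add_char_diff left_diff_distrib, simp add: mult_ac)
  also have "\<dots> = (if mat_mod p A = mat_mod p A' then of_nat p ^ 4 else 0)"
    using p by (auto simp: add_char_orthogonality eq mat_mod_m22 mod_eq_dvd_iff power4_eq_xxxx)
  finally show ?thesis .
qed

lemma finite_M2: "finite (carrier (M2 p))"
  unfolding carrier_M2 matrix_interval_eq_image by auto

lemma mat_mod_in_M2: "p > 0 \<Longrightarrow> A \<in> carrier_mat 2 2 \<Longrightarrow> mat_mod p A \<in> carrier (M2 p)"
  by (simp add: M2_carrier_iff)

lemma mat_mod_M2 [simp]: "A \<in> carrier (M2 p) \<Longrightarrow> mat_mod p A = A"
  by (auto simp: carrier_M2 matrix_interval_eq_image mat_mod_m22)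

lemma M2_carrier_mat [simp]: "A \<in> carrier (M2 p) \<Longrightarrow> A \<in> carrier_mat 2 2"
  by (simp add: M2_def)

text \<open>Expanding the square and summing over B first leaves only the diagonal terms, since
  reduced matrices with equal residues are equal.\<close>

lemma phase_parseval:
  fixes f :: "int mat \<Rightarrow> complex"
  assumes p: "p > 0" and S: "S \<subseteq> carrier (M2 p)"
  shows "(\<Sum>B\<in>carrier (M2 p). (cmod (\<Sum>A\<in>S. phase p A B * f A))\<^sup>2)
           = real p ^ 4 * (\<Sum>A\<in>S. (cmod (f A))\<^sup>2)"
proof -
  have finS: "finite S" using S finite_M2 finite_subset by blast
  have "complex_of_real (\<Sum>B\<in>carrier (M2 p). (cmod (\<Sum>A\<in>S. phase p A B * f A))\<^sup>2)
      = (\<Sum>B\<in>carrier (M2 p). \<Sum>A\<in>S. \<Sum>A'\<in>S. f A * cnj (f A') * (phase p A B * cnj (phase p A' B)))"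
    by (simp add: complex_norm_square sum_product mult_ac del: of_real_power)
  also have "\<dots> = (\<Sum>A\<in>S. \<Sum>A'\<in>S. 
      f A * cnj (f A') * (\<Sum>B\<in>carrier (M2 p). phase p A B * cnj (phase p A' B)))"
    by (subst sum.swap, rule sum.cong[OF refl], subst sum_distrib_left, rule sum.swap)
  also have "\<dots> = (\<Sum>A\<in>S. \<Sum>A'\<in>S. if A = A' then f A * cnj (f A') * of_nat p ^ 4 else 0)"
  proof (intro sum.cong refl)
    fix A A' assume "A \<in> S" "A' \<in> S"
    then have "A \<in> carrier (M2 p)" "A' \<in> carrier (M2 p)" using S by auto
    then show "f A * cnj (f A') * (\<Sum>B\<in>carrier (M2 p). phase p A B * cnj (phase p A' B))
        = (if A = A' then f A * cnj (f A') * of_nat p ^ 4 else 0)"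
      using p by (simp add: phase_orthogonality)
  qed
  also have "\<dots> = complex_of_real (real p ^ 4 * (\<Sum>A\<in>S. (cmod (f A))\<^sup>2))"
    using finS by (simp add: sum.delta sum_distrib_left complex_norm_square mult_ac del: of_real_power)
      (simp add: sum_distrib_left mult_ac)
  finally show ?thesis by (simp only: of_real_eq_iff)
qed

text \<open>Completion: by Fourier inversion the sum is at most p^-4 times \<open>F\<close> times
  the l1-norm of the Fourier transform of the indicator of the interval. That norm is a product of
  four one-dimensional sums, each at most \<open>real p * L\<close>.\<close>

lemma incomplete_sum_le:
  fixes f :: "int mat \<Rightarrow> complex"
  assumes p: "p > 1"
    and periodic: "\<And>A. A \<in> carrier_mat 2 2 \<Longrightarrow> f (mat_mod p A) = f A"
    and bound: "\<And>B. B \<in> carrier (M2 p) \<Longrightarrow> cmod (\<Sum>A\<in>carrier (M2 p). phase p A B * f A) \<le> F"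
    and I: "\<And>i j. i < 2 \<Longrightarrow> j < 2 \<Longrightarrow> \<exists>u v. I i j = {u..v}"
    and L: "\<And>i j. i < 2 \<Longrightarrow> j < 2 \<Longrightarrow> real (card (I i j)) + real p * (1 + ln (real p)) \<le> real p * L"
  shows "cmod (\<Sum>A\<in>matrix_interval I. f A) \<le> F * L ^ 4"
proof -
  let ?M = "carrier (M2 p)"
  define fh where "fh B = (\<Sum>A\<in>?M. phase p A B * f A)" for B
  define D where "D i j b = (\<Sum>n\<in>I i j. add_char p (n * b))" for i j b
  \<comment> \<open>Orthogonality keeps the single term at the residue of \<open>A\<close>, and
    periodicity of \<open>f\<close> leads back to \<open>A\<close> itself.\<close>
  have inversion: "of_nat p ^ 4 * f A = (\<Sum>B\<in>?M. fh B * cnj (phase p A B))"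
    if A: "A \<in> carrier_mat 2 2" for A
  proof -
    have "(\<Sum>B\<in>?M. fh B * cnj (phase p A B))
        = (\<Sum>A'\<in>?M. f A' * (\<Sum>B\<in>?M. phase p A' B * cnj (phase p A B)))"
      unfolding fh_def sum_distrib_left sum_distrib_right
      by (subst sum.swap) (simp add: mult_ac)
    also have "\<dots> = (\<Sum>A'\<in>?M. if A' = mat_mod p A then f A' * of_nat p ^ 4 else 0)"
      using p A by (intro sum.cong refl) (simp add: phase_orthogonality)
    also have "\<dots> = of_nat p ^ 4 * f A"
      using p A by (simp add: finite_M2 mat_mod_in_M2 periodic)
    finally show ?thesis ..
  qed
  have "of_nat p ^ 4 * (\<Sum>A\<in>matrix_interval I. f A)
      = (\<Sum>A\<in>matrix_interval I. \<Sum>B\<in>?M. fh B * cnj (phase p A B))"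
    unfolding sum_distrib_left
    by (intro sum.cong refl inversion) (simp add: matrix_interval_def)
  also have "\<dots> = (\<Sum>B\<in>?M. fh B * cnj (\<Sum>A\<in>matrix_interval I. phase p A B))"
    by (subst sum.swap) (simp add: sum_distrib_left)
  finally have "real p ^ 4 * cmod (\<Sum>A\<in>matrix_interval I. f A)
      = cmod (\<Sum>B\<in>?M. fh B * cnj (\<Sum>A\<in>matrix_interval I. phase p A B))"
    by (metis norm_mult norm_of_nat norm_power)
  also have "\<dots> \<le> (\<Sum>B\<in>?M. F * cmod (\<Sum>A\<in>matrix_interval I. phase p A B))"
    by (intro sum_norm_le) (auto simp: norm_mult fh_def simp del: cnj_sum intro!: mult_right_mono bound)
  also have "\<dots> = F * (\<Sum>B\<in>?M. cmod (\<Sum>A\<in>matrix_interval I. phase p A B))"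
    by (simp add: sum_distrib_left)
  finally have 1: "real p ^ 4 * cmod (\<Sum>A\<in>matrix_interval I. f A)
      \<le> F * (\<Sum>B\<in>?M. cmod (\<Sum>A\<in>matrix_interval I. phase p A B))" .
  \<comment> \<open>Both sums separate into coordinates; the crosswise pairing is why
    \<open>D (Suc 0) 0\<close> stands second and \<open>D 0 (Suc 0)\<close> third.\<close>
  have "(\<Sum>B\<in>?M. cmod (\<Sum>A\<in>matrix_interval I. phase p A B))
      = (\<Sum>b\<in>{0..<int p}. cmod (D 0 0 b)) * (\<Sum>b\<in>{0..<int p}. cmod (D (Suc 0) 0 b))
        * (\<Sum>b\<in>{0..<int p}. cmod (D 0 (Suc 0) b)) * (\<Sum>b\<in>{0..<int p}. cmod (D (Suc 0) (Suc 0) b))"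
  proof -
    have "(\<Sum>A\<in>matrix_interval I. phase p A (m22 a' b' c' e'))
        = D 0 0 a' * D (Suc 0) 0 b' * D 0 (Suc 0) c' * D (Suc 0) (Suc 0) e'" for a' b' c' e'
    proof -
      have "(\<Sum>A\<in>matrix_interval I. phase p A (m22 a' b' c' e'))
          = (\<Sum>a\<in>I 0 0. \<Sum>b\<in>I 0 (Suc 0). \<Sum>c\<in>I (Suc 0) 0. \<Sum>e\<in>I (Suc 0) (Suc 0).
               add_char p (a * a') * add_char p (b * c') * add_char p (c * b') * add_char p (e * e'))"
        unfolding sum_matrix_interval phase_m22_split by (simp add: mult_ac)
      also have "\<dots> = D 0 0 a' * D 0 (Suc 0) c' * D (Suc 0) 0 b' * D (Suc 0) (Suc 0) e'"
        unfolding D_def by (rule sum_prod4)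
      finally show ?thesis by (simp add: mult_ac)
    qed
    then show ?thesis
      unfolding carrier_M2 sum_matrix_interval by (subst sum_prod4[symmetric]) (simp add: norm_mult)
  qed
  also have "\<dots> \<le> (real p * L) * (real p * L) * (real p * L) * (real p * L)"
  proof -
    have *: "(\<Sum>b\<in>{0..<int p}. cmod (D i j b)) \<le> real p * L" if ij: "i < 2" "j < 2" for i j
    proof -
      obtain u v where uv: "I i j = {u..v}" using I ij by blast
      show ?thesis
        using L[OF ij] sum_norm_geometric_add_char_le[OF p, of u v] unfolding D_def uv by linarith
    qed
    have pos: "0 \<le> (\<Sum>b\<in>{0..<int p}. cmod (D i j b))" for i j
      by (simp add: sum_nonneg)
    have posL: "0 \<le> real p * L" using pos[of 0 0] *[of 0 0] by simp
    show ?thesis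
      by (intro mult_mono * mult_nonneg_nonneg pos posL) auto
  qed
  finally have 2: "(\<Sum>B\<in>?M. cmod (\<Sum>A\<in>matrix_interval I. phase p A B)) \<le> real p ^ 4 * L ^ 4"
    by (simp add: power4_eq_xxxx mult_ac)
  have "0\<^sub>m 2 2 \<in> ?M" using p by (auto simp: M2_carrier_iff mat_mod_def)
  \<comment> \<open>\<open>F\<close> bounds an absolute value at the zero matrix, so it may multiply
    an inequality.\<close>
  then have "0 \<le> F" using bound norm_ge_zero order_trans by blast
  with 1 2 have "real p ^ 4 * cmod (\<Sum>A\<in>matrix_interval I. f A) \<le> F * (real p ^ 4 * L ^ 4)"
    using mult_left_mono order_trans by blast
  then have "real p ^ 4 * cmod (\<Sum>A\<in>matrix_interval I. f A) \<le> real p ^ 4 * (F * L ^ 4)"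
    by (simp add: mult_ac)
  then show ?thesis using p by simp
qed

section \<open>Gauss sums of representations of the general linear group\<close>

text \<open>The entries may be arbitrary integer expressions, so products are computed over the
  integers and compared by congruences of entries.\<close>

definition m22_mod :: "nat \<Rightarrow> int \<Rightarrow> int \<Rightarrow> int \<Rightarrow> int \<Rightarrow> int mat" where
  "m22_mod p a b c e = mat_mod p (m22 a b c e)"

lemma m22_mod_in_M2 [simp]: "p > 0 \<Longrightarrow> m22_mod p a b c e \<in> carrier (M2 p)"
  by (simp add: m22_mod_def mat_mod_in_M2)

lemma M2_eq_m22_mod:
  assumes "A \<in> carrier (M2 p)"
  shows "A = m22_mod p (A $$ (0, 0)) (A $$ (0, Suc 0)) (A $$ (Suc 0, 0)) (A $$ (Suc 0, Suc 0))"
  unfolding m22_mod_def using carrier_mat_2_eq_m22[OF M2_carrier_mat[OF assms]] mat_mod_M2[OF assms]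
  by metis

lemma m22_mod_eq_iff:
  "m22_mod p a b c e = m22_mod p a' b' c' e' \<longleftrightarrow>
     [a = a'] (mod int p) \<and> [b = b'] (mod int p) \<and> [c = c'] (mod int p) \<and> [e = e'] (mod int p)"
  by (simp add: m22_mod_def mat_mod_m22 cong_def)

lemma m22_mod_mult:
  "m22_mod p a b c e \<otimes>\<^bsub>M2 p\<^esub> m22_mod p a' b' c' e'
     = m22_mod p (a * a' + b * c') (a * b' + b * e') (c * a' + e * c') (c * b' + e * e')"
proof -
  have "m22_mod p a b c e \<otimes>\<^bsub>M2 p\<^esub> m22_mod p a' b' c' e'
      = mat_mod p (mat_mod p (m22 a b c e) * mat_mod p (m22 a' b' c' e'))"
    by (simp only: m22_mod_def M2_mult)
  also have "\<dots> = mat_mod p (m22 a b c e * m22 a' b' c' e')"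
    by (simp add: mat_mod_mult_left[of _ 2] mat_mod_mult_right[of _ 2])
  finally show ?thesis by (simp add: m22_mult m22_mod_def)
qed

lemma one_M2: "p > 1 \<Longrightarrow> \<one>\<^bsub>M2 p\<^esub> = m22_mod p 1 0 0 1"
  unfolding M2_one m22_mod_def mat_mod_m22
  by (auto simp: m22_def less_2_cases_iff intro!: eq_matI)

lemma GL2_mult: "A \<otimes>\<^bsub>GL2 p\<^esub> B = A \<otimes>\<^bsub>M2 p\<^esub> B"
  by (simp add: GL2_def units_of_def)

lemma GL2_one: "\<one>\<^bsub>GL2 p\<^esub> = \<one>\<^bsub>M2 p\<^esub>"
  by (simp add: GL2_def units_of_def)

lemma GL2_subset: "carrier (GL2 p) \<subseteq> carrier (M2 p)"
  by (auto simp: GL2_def units_of_def Units_def)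

lemma GL2_in_M2 [simp]: "A \<in> carrier (GL2 p) \<Longrightarrow> A \<in> carrier (M2 p)"
  using GL2_subset by blast

lemma cong_inverse_exists:
  fixes a :: int
  assumes "prime p" "\<not> int p dvd a"
  shows "\<exists>u. [a * u = 1] (mod int p)"
proof -
  have "coprime a (int p)"
    using assms by (metis coprime_commute prime_imp_coprime prime_nat_int_transfer)
  then show ?thesis using cong_solve_coprime_int by blast
qed

text \<open>The inverse is the adjugate multiplied by an inverse u of the determinant modulo
  p.\<close>

lemma m22_mod_in_GL2:
  assumes p: "prime p" and det: "\<not> int p dvd a * e - b * c"
  shows "m22_mod p a b c e \<in> carrier (GL2 p)"
proof -
  have p1: "p > 1" using p prime_gt_1_nat by blast
  obtain u where u: "[(a * e - b * c) * u = 1] (mod int p)"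
    using cong_inverse_exists[OF p det] by blast
  have u': "[a * (u * e) + b * (- (u * c)) = 1] (mod int p)"
    "[c * (- (u * b)) + e * (u * a) = 1] (mod int p)"
    "[(u * e) * a + (- (u * b)) * c = 1] (mod int p)"
    "[(- (u * c)) * b + (u * a) * e = 1] (mod int p)"
    using u by (simp_all add: algebra_simps)
  have "m22_mod p (u * e) (- (u * b)) (- (u * c)) (u * a) \<otimes>\<^bsub>M2 p\<^esub> m22_mod p a b c e = \<one>\<^bsub>M2 p\<^esub>"
    "m22_mod p a b c e \<otimes>\<^bsub>M2 p\<^esub> m22_mod p (u * e) (- (u * b)) (- (u * c)) (u * a) = \<one>\<^bsub>M2 p\<^esub>"
    using u' p1 by (simp_all add: m22_mod_mult one_M2 m22_mod_eq_iff mult_ac)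
  then show ?thesis
    using p1 unfolding GL2_def units_of_def Units_def by auto
qed

text \<open>The top left entry of the product with the inverse is a combination of a and b and is
  congruent to 1.\<close>

lemma GL2_first_row_nonzero:
  assumes p: "prime p" and "m22_mod p a b c e \<in> carrier (GL2 p)"
  shows "\<not> int p dvd a \<or> \<not> int p dvd b"
proof -
  have p1: "p > 1" using p prime_gt_1_nat by blast
  obtain K where K: "K \<in> carrier (M2 p)" "m22_mod p a b c e \<otimes>\<^bsub>M2 p\<^esub> K = \<one>\<^bsub>M2 p\<^esub>"
    using assms unfolding GL2_def units_of_def Units_def by auto
  obtain a' b' c' e' where "K = m22_mod p a' b' c' e'"
    using M2_eq_m22_mod[OF K(1)] by blast
  then have "[a * a' + b * c' = 1] (mod int p)"
    using K(2) p1 by (simp add: m22_mod_mult one_M2 m22_mod_eq_iff)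
  then have "\<not> int p dvd a * a' + b * c'"
    using p1 by (metis cong_dvd_iff nat_dvd_1_iff_1 int_dvd_int_iff of_nat_1 less_irrefl)
  then show ?thesis by (metis dvd_add dvd_mult2)
qed

text \<open>Left multiplication by \<open>m22_mod p 1 0 0 0\<close> keeps the first row and clears
  the second. So K is any invertible matrix with first row (a, b): second row (1, 0) gives
  determinant -b, and (0, 1) gives a.\<close>

lemma row_completion:
  assumes p: "prime p" and "\<not> int p dvd a \<or> \<not> int p dvd b"
  shows "\<exists>K\<in>carrier (GL2 p). m22_mod p 1 0 0 0 \<otimes>\<^bsub>M2 p\<^esub> K = m22_mod p a b 0 0"
proof (cases "int p dvd a")
  case True
  then have "m22_mod p a b 1 0 \<in> carrier (GL2 p)"
    using assms by (intro m22_mod_in_GL2) auto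
  then show ?thesis by (intro bexI[of _ "m22_mod p a b 1 0"]) (simp_all add: m22_mod_mult)
next
  case False
  then have "m22_mod p a b 0 1 \<in> carrier (GL2 p)"
    using assms by (intro m22_mod_in_GL2) auto
  then show ?thesis by (intro bexI[of _ "m22_mod p a b 0 1"]) (simp_all add: m22_mod_mult)
qed

text \<open>Classification by rank. In rank one with a non-zero first row, the second row is a
  multiple of it and P is lower unitriangular; if the first row vanishes, P exchanges the
  rows.\<close>

lemma M2_singular_cases:
  assumes p: "prime p" and B: "B \<in> carrier (M2 p)"
  obtains "B \<in> carrier (GL2 p)"
  | "B = m22_mod p 0 0 0 0"
  | P Q where "P \<in> carrier (GL2 p)" "Q \<in> carrier (GL2 p)"
      "B = P \<otimes>\<^bsub>M2 p\<^esub> (m22_mod p 1 0 0 0 \<otimes>\<^bsub>M2 p\<^esub> Q)"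
proof -
  have p1: "p > 1" using p prime_gt_1_nat by blast
  obtain a b c e where B_eq: "B = m22_mod p a b c e" using M2_eq_m22_mod[OF B] by blast
  consider "\<not> int p dvd a * e - b * c"
    | "int p dvd a * e - b * c" "\<not> int p dvd a"
    | "int p dvd a * e - b * c" "int p dvd a" "\<not> int p dvd b"
    | "int p dvd a" "int p dvd b" "\<not> int p dvd c \<or> \<not> int p dvd e"
    | "int p dvd a" "int p dvd b" "int p dvd c" "int p dvd e"
    by blast
  then show thesis
  proof cases
    case 1
    then show thesis using that(1) m22_mod_in_GL2[OF p] B_eq by blast
  next
    case 2
    obtain u where u: "[a * u = 1] (mod int p)" using cong_inverse_exists[OF p 2(2)] by blast
    obtain Q where Q: "Q \<in> carrier (GL2 p)" "m22_mod p 1 0 0 0 \<otimes>\<^bsub>M2 p\<^esub> Q = m22_mod p a b 0 0"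
      using row_completion[OF p] 2 by blast
    \<comment> \<open>With u inverse to a, the vanishing determinant makes the second row c u times
      the first.\<close>
    have "[c * (a * u) = c * 1] (mod int p)" by (intro cong_mult cong_refl u)
    then have 3: "[c = c * u * a] (mod int p)" by (simp add: cong_sym mult_ac)
    have "[e * (a * u) = e * 1] (mod int p)" by (intro cong_mult cong_refl u)
    moreover have "[a * e = b * c] (mod int p)"
      using 2 by (simp add: cong_iff_dvd_diff)
    then have "[(a * e) * u = (b * c) * u] (mod int p)"
      by (rule cong_scalar_right)
    ultimately have 4: "[e = c * u * b] (mod int p)"
      by (simp add: mult_ac) (metis cong_sym cong_trans)
    have "m22_mod p 1 0 (c * u) 1 \<in> carrier (GL2 p)"
      using p by (intro m22_mod_in_GL2) auto
    moreover have "B = m22_mod p 1 0 (c * u) 1 \<otimes>\<^bsub>M2 p\<^esub> (m22_mod p 1 0 0 0 \<otimes>\<^bsub>M2 p\<^esub> Q)"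
      using 3 4 unfolding Q(2) B_eq by (simp add: m22_mod_mult m22_mod_eq_iff)
    ultimately show thesis using that(3) Q(1) by blast
  next
    case 3
    obtain u where u: "[b * u = 1] (mod int p)" using cong_inverse_exists[OF p 3(3)] by blast
    obtain Q where Q: "Q \<in> carrier (GL2 p)" "m22_mod p 1 0 0 0 \<otimes>\<^bsub>M2 p\<^esub> Q = m22_mod p a b 0 0"
      using row_completion[OF p] 3 by blast
    have "[e * (b * u) = e * 1] (mod int p)" by (intro cong_mult cong_refl u)
    then have 4: "[e = e * u * b] (mod int p)" by (simp add: cong_sym mult_ac)
    \<comment> \<open>Here a is 0 modulo p, so singularity forces c to vanish and the second row is
      e u times the first.\<close>
    have "int p dvd b * c" using 3 by (metis dvd_mult2 dvd_diff_right_iff)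
    then have "int p dvd c" using 3 p by (simp add: prime_dvd_mult_iff)
    then have 5: "[c = e * u * a] (mod int p)"
      using 3 by (simp add: cong_iff_dvd_diff)
    have "m22_mod p 1 0 (e * u) 1 \<in> carrier (GL2 p)"
      using p by (intro m22_mod_in_GL2) auto
    moreover have "B = m22_mod p 1 0 (e * u) 1 \<otimes>\<^bsub>M2 p\<^esub> (m22_mod p 1 0 0 0 \<otimes>\<^bsub>M2 p\<^esub> Q)"
      using 4 5 unfolding Q(2) B_eq by (simp add: m22_mod_mult m22_mod_eq_iff)
    ultimately show thesis using that(3) Q(1) by blast
  next
    case 4
    obtain Q where Q: "Q \<in> carrier (GL2 p)" "m22_mod p 1 0 0 0 \<otimes>\<^bsub>M2 p\<^esub> Q = m22_mod p c e 0 0"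
      using row_completion[OF p] 4 by blast
    have "m22_mod p 0 1 1 0 \<in> carrier (GL2 p)"
      using p by (intro m22_mod_in_GL2) auto
    moreover have "B = m22_mod p 0 1 1 0 \<otimes>\<^bsub>M2 p\<^esub> (m22_mod p 1 0 0 0 \<otimes>\<^bsub>M2 p\<^esub> Q)"
      using 4 unfolding Q(2) B_eq by (simp add: m22_mod_mult m22_mod_eq_iff cong_0_iff)
    ultimately show thesis using that(3) Q(1) by blast
  next
    case 5
    then have "B = m22_mod p 0 0 0 0" unfolding B_eq by (simp add: m22_mod_eq_iff cong_0_iff)
    then show thesis by (rule that(2))
  qed
qed

text \<open>\<open>N\<close> has the form v k^T, so both its trace and its eigenvalue on v equal k^T
  v.\<close>

lemma mult_vec_eq_trace_smult:
  fixes N :: "complex mat"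
  assumes N: "N \<in> carrier_mat n n" and v: "v \<in> carrier_vec n"
    and rank1: "\<And>x. x \<in> carrier_vec n \<Longrightarrow> \<exists>k. N *\<^sub>v x = k \<cdot>\<^sub>v v"
  shows "N *\<^sub>v v = mat_trace N \<cdot>\<^sub>v v"
proof -
  have "\<exists>k. N *\<^sub>v unit_vec n j = k \<cdot>\<^sub>v v" for j
    by (rule rank1) simp
  then obtain k where k: "\<And>j. N *\<^sub>v unit_vec n j = k j \<cdot>\<^sub>v v" by metis
  have N_eq: "N $$ (i, j) = k j * v $ i" if "i < n" "j < n" for i j
  proof -
    have "N $$ (i, j) = (N *\<^sub>v unit_vec n j) $ i" using N that by simp
    then show ?thesis using v that by (simp add: k del: index_mult_mat_vec)
  qed
  show ?thesis
  proof (rule eq_vecI)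
    fix i assume "i < dim_vec (mat_trace N \<cdot>\<^sub>v v)"
    then have i: "i < n" using v by simp
    have "(N *\<^sub>v v) $ i = (\<Sum>j<n. k j * v $ i * v $ j)"
      using N v i by (auto simp: scalar_prod_def lessThan_atLeast0 N_eq)
    also have "\<dots> = (\<Sum>j<n. k j * v $ j) * v $ i"
      by (simp add: sum_distrib_left sum_distrib_right mult_ac)
    also have "(\<Sum>j<n. k j * v $ j) = mat_trace N"
      using N by (simp add: mat_trace_def N_eq)
    finally show "(N *\<^sub>v v) $ i = (mat_trace N \<cdot>\<^sub>v v) $ i" using v i by simp
  qed (use N v in auto)
qed

section \<open>Gauss sums: translation, Parseval, and the arguments of rank two and zero\<close>

locale gl2_irrep =
  fixes p d :: nat and \<rho> :: "int mat \<Rightarrow> complex mat"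
  assumes prime_p: "prime p" and irrep_rho: "irreducible_representation (GL2 p) d \<rho>"
begin

lemma p_gt_1: "p > 1" using prime_p prime_gt_1_nat by blast
lemma p_pos: "p > 0" using p_gt_1 by simp

sublocale M: monoid "M2 p" by (rule monoid_M2[OF p_gt_1])

sublocale finite_irrep "GL2 p" d \<rho>
  using group_GL2[OF p_gt_1] irrep_rho finite_subset[OF GL2_subset finite_M2]
  by (intro finite_irrep.intro finite_irrep_axioms.intro)

abbreviation mult_p (infixl "\<star>" 70) where "A \<star> B \<equiv> A \<otimes>\<^bsub>M2 p\<^esub> B"
abbreviation inv_p where "inv_p \<equiv> m_inv (GL2 p)"
abbreviation GL where "GL \<equiv> carrier (GL2 p)"
abbreviation EL where "EL \<equiv> m22_mod p"
abbreviation E0 where "E0 \<equiv> EL 1 0 0 0"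
abbreviation swap where "swap \<equiv> EL 0 1 1 0"

lemma GL_mult [simp]: "K \<in> GL \<Longrightarrow> K' \<in> GL \<Longrightarrow> K \<star> K' \<in> GL"
  using m_closed by (simp add: GL2_mult)

lemma GL_inv [simp]: "K \<in> GL \<Longrightarrow> inv_p K \<in> GL"
  by (rule inv_closed)

lemma GL_inv_cancel:
  assumes "K \<in> GL" "B \<in> carrier (M2 p)"
  shows "K \<star> (inv_p K \<star> B) = B" "inv_p K \<star> (K \<star> B) = B" "B \<star> K \<star> inv_p K = B" "B \<star> inv_p K \<star> K = B"
proof -
  have "K \<star> inv_p K = \<one>\<^bsub>M2 p\<^esub>" "inv_p K \<star> K = \<one>\<^bsub>M2 p\<^esub>"
    using assms r_inv[of K] l_inv[of K] by (simp_all add: GL2_mult GL2_one)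
  then show "K \<star> (inv_p K \<star> B) = B" "inv_p K \<star> (K \<star> B) = B" "B \<star> K \<star> inv_p K = B" "B \<star> inv_p K \<star> K = B"
    using assms by (simp_all flip: M.m_assoc) (simp_all add: M.m_assoc)
qed

lemma rho_star: "K \<in> GL \<Longrightarrow> K' \<in> GL \<Longrightarrow> \<rho> (K \<star> K') = \<rho> K * \<rho> K'"
  using rho_mult by (simp add: GL2_mult)

lemma rho_star_vec:
  "K \<in> GL \<Longrightarrow> K' \<in> GL \<Longrightarrow> x \<in> carrier_vec d \<Longrightarrow> \<rho> (K \<star> K') *\<^sub>v x = \<rho> K *\<^sub>v (\<rho> K' *\<^sub>v x)"
  using rho_mult_vec by (simp add: GL2_mult)

text \<open>The matrix-valued Gauss sum G(B): the Fourier transform of \<open>\<rho>\<close>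
  extended by zero to singular matrices.\<close>

definition gauss :: "int mat \<Rightarrow> complex mat" where
  "gauss B = rep_sum (\<lambda>A. phase p A B)"

lemma gauss_carrier [simp]: "gauss B \<in> carrier_mat d d"
  by (simp add: gauss_def)

lemma gauss_vec_carrier [simp]: "gauss B *\<^sub>v x \<in> carrier_vec d"
  by (simp add: gauss_def)

text \<open>Translating the summation variable by K multiplies the frequency by K on the
  right.\<close>

lemma rho_mult_gauss:
  assumes K: "K \<in> GL" and B: "B \<in> carrier (M2 p)"
  shows "\<rho> K * gauss (B \<star> K) = gauss B"
  unfolding gauss_def rho_mult_rep_sum[OF K]
proof (rule rep_sum_cong)
  fix A assume A: "A \<in> GL"
  have "phase p (inv_p K \<star> A) (B \<star> K) = phase p (K \<star> (inv_p K \<star> A)) B"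
    using K A B p_pos by (intro phase_assoc M2_carrier_mat[of _ p]) auto
  then show "phase p (inv_p K \<otimes>\<^bsub>GL2 p\<^esub> A) (B \<star> K) = phase p A B"
    using K A by (simp add: GL2_mult GL_inv_cancel)
qed

lemma gauss_mult_rho:
  assumes K: "K \<in> GL" and B: "B \<in> carrier (M2 p)"
  shows "gauss (K \<star> B) * \<rho> K = gauss B"
  unfolding gauss_def rep_sum_mult_rho[OF K]
proof (rule rep_sum_cong)
  fix A assume A: "A \<in> GL"
  have "phase p (A \<star> inv_p K) (K \<star> B) = phase p (A \<star> inv_p K \<star> K) B"
    using K A B p_pos by (intro phase_assoc M2_carrier_mat[of _ p]) auto
  then show "phase p (A \<otimes>\<^bsub>GL2 p\<^esub> inv_p K) (K \<star> B) = phase p A B"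
    using K A by (simp add: GL2_mult GL_inv_cancel)
qed

text \<open>Scalar Parseval is applied to each coordinate of \<rho>(g) \<rho>(A) x as a function of
  A. After reassembly, every A contributes the same invariant norm.\<close>

lemma inv_norm2_gauss_parseval:
  assumes x: "x \<in> carrier_vec d"
  shows "(\<Sum>B\<in>carrier (M2 p). inv_norm2 (gauss B *\<^sub>v x)) = real p ^ 4 * (real (card GL) * inv_norm2 x)"
proof -
  have "(\<Sum>B\<in>carrier (M2 p). inv_norm2 (gauss B *\<^sub>v x))
     = (\<Sum>B\<in>carrier (M2 p). \<Sum>g\<in>GL. \<Sum>i<d. (cmod (\<Sum>A\<in>GL. phase p A B * (\<rho> g *\<^sub>v (\<rho> A *\<^sub>v x)) $ i))\<^sup>2)"
    unfolding inv_norm2_def vec_norm2_def gauss_def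
    using x by (intro sum.cong refl) (auto simp: mult_rep_sum_vec_index[of _ d] simp del: index_mult_mat_vec)
  also have "\<dots> = (\<Sum>g\<in>GL. \<Sum>i<d. \<Sum>B\<in>carrier (M2 p).
      (cmod (\<Sum>A\<in>GL. phase p A B * (\<rho> g *\<^sub>v (\<rho> A *\<^sub>v x)) $ i))\<^sup>2)"
    by (subst sum.swap, rule sum.cong[OF refl], rule sum.swap)
  also have "\<dots> = (\<Sum>g\<in>GL. \<Sum>i<d. real p ^ 4 * (\<Sum>A\<in>GL. (cmod ((\<rho> g *\<^sub>v (\<rho> A *\<^sub>v x)) $ i))\<^sup>2))"
    by (simp only: phase_parseval[OF p_pos GL2_subset])
  also have "\<dots> = real p ^ 4 * (\<Sum>g\<in>GL. \<Sum>A\<in>GL. \<Sum>i<d. (cmod ((\<rho> g *\<^sub>v (\<rho> A *\<^sub>v x)) $ i))\<^sup>2)"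
    unfolding sum_distrib_left by (intro sum.cong refl, rule sum.swap)
  also have "(\<Sum>g\<in>GL. \<Sum>A\<in>GL. \<Sum>i<d. (cmod ((\<rho> g *\<^sub>v (\<rho> A *\<^sub>v x)) $ i))\<^sup>2)
      = (\<Sum>A\<in>GL. \<Sum>g\<in>GL. \<Sum>i<d. (cmod ((\<rho> g *\<^sub>v (\<rho> A *\<^sub>v x)) $ i))\<^sup>2)"
    by (rule sum.swap)
  also have "\<dots> = (\<Sum>A\<in>GL. inv_norm2 (\<rho> A *\<^sub>v x))"
    unfolding inv_norm2_def vec_norm2_def by (intro sum.cong refl) auto
  also have "\<dots> = real (card GL) * inv_norm2 x"
    using x by (simp add: inv_norm2_rho)
  finally show ?thesis .
qed

text \<open>The norm of G(B) x is constant along the orbit of B under right multiplication. Summing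
  over the group meets each point of the orbit at most \<open>N\<close> times, so Parseval bounds
  the total, and the order of the group cancels.\<close>

lemma inv_norm2_gauss_le:
  assumes x: "x \<in> carrier_vec d" and B: "B \<in> carrier (M2 p)"
    and fibre: "\<And>B'. B' \<in> carrier (M2 p) \<Longrightarrow> card {K \<in> GL. B \<star> K = B'} \<le> N"
  shows "inv_norm2 (gauss B *\<^sub>v x) \<le> real N * real p ^ 4 * inv_norm2 x"
proof -
  let ?F = "\<lambda>B. inv_norm2 (gauss B *\<^sub>v x)"
  have F: "?F (B \<star> K) = ?F B" if K: "K \<in> GL" for K
  proof -
    have "gauss B *\<^sub>v x = \<rho> K *\<^sub>v (gauss (B \<star> K) *\<^sub>v x)"
      using x K by (simp add: assoc_mult_mat_vec[of _ d d _ d, symmetric] rho_mult_gauss[OF K B])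
    then show ?thesis using K by (simp add: inv_norm2_rho)
  qed
  have "real (card GL) * ?F B = (\<Sum>K\<in>GL. ?F (B \<star> K))" by (simp add: F)
  also have "\<dots> = (\<Sum>B'\<in>carrier (M2 p). \<Sum>K\<in>{K \<in> GL. B \<star> K = B'}. ?F (B \<star> K))"
    using B by (intro sum.group[symmetric] finite_carrier finite_M2) auto
  also have "\<dots> = (\<Sum>B'\<in>carrier (M2 p). real (card {K \<in> GL. B \<star> K = B'}) * ?F B')"
    by (intro sum.cong refl) simp
  also have "\<dots> \<le> (\<Sum>B'\<in>carrier (M2 p). real N * ?F B')"
    by (intro sum_mono mult_right_mono inv_norm2_nonneg) (use fibre in auto)
  also have "\<dots> = real N * (real p ^ 4 * (real (card GL) * inv_norm2 x))"
    by (simp add: inv_norm2_gauss_parseval[OF x] flip: sum_distrib_left)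
  finally have "real (card GL) * ?F B \<le> real (card GL) * (real N * real p ^ 4 * inv_norm2 x)"
    by (simp add: mult_ac)
  moreover have "card GL > 0"
    using finite_carrier one_closed by (auto simp: card_gt_0_iff)
  ultimately show ?thesis by simp
qed

lemma cmod_trace_gauss_invertible:
  assumes B: "B \<in> GL"
  shows "cmod (mat_trace (gauss B)) \<le> real d * real p ^ 2"
proof -
  let ?I = "\<one>\<^bsub>M2 p\<^esub>"
  \<comment> \<open>Both \<rho>(K) G(K) and G(K) \<rho>(K) equal G(1), so G(1) commutes with
    \<rho>(K).\<close>
  have "\<rho> K * gauss ?I = gauss ?I * \<rho> K" if K: "K \<in> GL" for K
  proof -
    have 1: "\<rho> K * gauss K = gauss ?I" using rho_mult_gauss[OF K, of ?I] K by simp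
    have 2: "gauss K * \<rho> K = gauss ?I" using gauss_mult_rho[OF K, of ?I] K by simp
    have "\<rho> K * gauss ?I = \<rho> K * gauss K * \<rho> K"
      using K by (simp add: assoc_mult_mat[of _ d d _ d _ d] 2)
    then show ?thesis by (simp add: 1)
  qed
  then obtain k where k: "gauss ?I = k \<cdot>\<^sub>m 1\<^sub>m d"
    using schur[of "gauss ?I"] by auto
  have "cmod k \<le> real p ^ 2"
  proof -
    define x :: "complex vec" where "x = unit_vec d 0"
    have x: "x \<in> carrier_vec d" "x \<noteq> 0\<^sub>v d"
      using d_pos by (auto simp: x_def unit_vec_nonzero)
    have "card {K \<in> GL. ?I \<star> K = B'} \<le> 1" for B'
    proof -
      have "{K \<in> GL. ?I \<star> K = B'} \<subseteq> {B'}" by auto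
      then show ?thesis using card_mono[of "{B'}"] by simp
    qed
    then have "inv_norm2 (gauss ?I *\<^sub>v x) \<le> real 1 * real p ^ 4 * inv_norm2 x"
      using x by (intro inv_norm2_gauss_le) auto
    moreover have "gauss ?I *\<^sub>v x = k \<cdot>\<^sub>v x"
      unfolding k using x by (simp add: smult_mat_mult_vec[of _ d d])
    ultimately have "(cmod k)\<^sup>2 * inv_norm2 x \<le> (real p ^ 2)\<^sup>2 * inv_norm2 x"
      using x by (simp add: inv_norm2_smult flip: power_mult)
    then have "(cmod k)\<^sup>2 \<le> (real p ^ 2)\<^sup>2"
      using inv_norm2_pos[OF x] by simp
    then show ?thesis by (rule power2_le_imp_le) simp
  qed
  moreover have "gauss B = k \<cdot>\<^sub>m \<rho> (inv_p B)"
  proof -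
    have "\<rho> B * gauss B = gauss ?I" using rho_mult_gauss[OF B, of ?I] B by simp
    then have "\<rho> (inv_p B) * (\<rho> B * gauss B) = \<rho> (inv_p B) * (k \<cdot>\<^sub>m 1\<^sub>m d)"
      by (simp add: k)
    then show ?thesis
      using B left_mult_one_mat[OF gauss_carrier]
      by (simp add: assoc_mult_mat[of _ d d _ d _ d, symmetric] rho_inv
          mult_smult_distrib[of _ d d _ d])
  qed
  then have "cmod (mat_trace (gauss B)) = cmod k * cmod (mat_trace (\<rho> (inv_p B)))"
    using B by (simp add: mat_trace_smult[of _ d] norm_mult)
  ultimately show ?thesis
    using cmod_character_le[of "inv_p B"] B
    by (metis GL_inv mult.commute mult_mono norm_ge_zero of_nat_0_le_iff zero_le_power)
qed

lemma gauss_zero: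
  assumes nontriv: "\<not> trivial_representation (GL2 p) d \<rho>"
  shows "gauss (EL 0 0 0 0) = 0\<^sub>m d d"
proof (rule mat_eqI_vec[of _ d d])
  fix x :: "complex vec" assume x: "x \<in> carrier_vec d"
  let ?Z = "EL 0 0 0 0"
  have "\<rho> K *\<^sub>v (gauss ?Z *\<^sub>v x) = gauss ?Z *\<^sub>v x" if K: "K \<in> GL" for K
  proof -
    obtain a b c e where "K = EL a b c e" using M2_eq_m22_mod K GL2_in_M2 by blast
    then have "?Z \<star> K = ?Z" by (simp add: m22_mod_mult)
    then have "\<rho> K * gauss ?Z = gauss ?Z" using rho_mult_gauss[OF K, of ?Z] p_pos by simp
    then show ?thesis using K x by (simp add: assoc_mult_mat_vec[of _ d d _ d, symmetric])
  qed
  then have "gauss ?Z *\<^sub>v x = 0\<^sub>v d"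
    using fixed_vector_imp_trivial[of "gauss ?Z *\<^sub>v x"] nontriv by auto
  then show "gauss ?Z *\<^sub>v x = 0\<^sub>m d d *\<^sub>v x"
    using x by (auto simp: scalar_prod_def intro!: eq_vecI)
qed auto

section \<open>The mirabolic subgroup and its fixed vectors\<close>

text \<open>The stabiliser of \<open>E0\<close> under right multiplication, which consists of the
  invertible matrices with first row (1, 0).\<close>

definition H where "H = {K \<in> GL. E0 \<star> K = E0}"

lemma H_GL: "h \<in> H \<Longrightarrow> h \<in> GL"
  by (simp add: H_def)

lemma E0_M2 [simp]: "E0 \<in> carrier (M2 p)"
  using p_pos by simp

text \<open>\<open>E0 \<star> g\<close> records the first row of g, and this row determines the
  coset H g.\<close>

lemma coset_H:
  assumes "g \<in> GL" "g' \<in> GL" "E0 \<star> g = E0 \<star> g'"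
  shows "g \<star> inv_p g' \<in> H"
proof -
  have "E0 \<star> (g \<star> inv_p g') = E0 \<star> g' \<star> inv_p g'"
    using assms by (simp flip: M.m_assoc)
  then show ?thesis
    using assms by (simp add: H_def GL_inv_cancel)
qed

lemma H_mult_left_iff:
  assumes h: "h \<in> H" and g: "g \<in> GL"
  shows "inv_p h \<star> g \<in> H \<longleftrightarrow> g \<in> H"
proof -
  have "E0 \<star> inv_p h = E0 \<star> h \<star> inv_p h" using h by (simp add: H_def)
  also have "\<dots> = E0" using H_GL[OF h] by (simp add: GL_inv_cancel)
  finally have "E0 \<star> (inv_p h \<star> g) = E0 \<star> g"
    using H_GL[OF h] g by (simp flip: M.m_assoc)
  then show ?thesis using h g by (simp add: H_def)
qed

lemma H_mult_right_iff:
  assumes h: "h \<in> H" and g: "g \<in> GL"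
  shows "g \<star> inv_p h \<in> H \<longleftrightarrow> g \<in> H"
proof
  assume "g \<star> inv_p h \<in> H"
  then have "E0 \<star> (g \<star> inv_p h) \<star> h = E0 \<star> h" by (simp add: H_def)
  then have "E0 \<star> (g \<star> inv_p h \<star> h) = E0"
    using H_GL[OF h] h g by (simp add: M.m_assoc) (simp add: H_def)
  then show "g \<in> H" using h g by (simp add: H_def GL_inv_cancel)
next
  assume "g \<in> H"
  then show "g \<star> inv_p h \<in> H" using h g by (intro coset_H) (auto simp: H_def)
qed

lemma m22_mod_in_H: "\<lbrakk>EL a b c e \<in> GL; [a = 1] (mod int p); [b = 0] (mod int p)\<rbrakk> \<Longrightarrow> EL a b c e \<in> H"
  by (simp add: H_def m22_mod_mult m22_mod_eq_iff)

declare H_GL [simp]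

lemma lower_in_GL [simp]: "EL 1 0 c 1 \<in> GL"
  using prime_p by (intro m22_mod_in_GL2) auto

lemma lower_in_H [simp]: "EL 1 0 c 1 \<in> H"
  by (intro m22_mod_in_H) auto

lemma swap_in_GL [simp]: "swap \<in> GL"
  using prime_p by (intro m22_mod_in_GL2) auto

text \<open>The averaging projection onto the \<open>H\<close>-fixed vectors, scaled by the order of
  \<open>H\<close>.\<close>

definition hsum where "hsum = rep_sum (\<lambda>g. if g \<in> H then 1 else 0)"

lemma hsum_carrier [simp]: "hsum \<in> carrier_mat d d"
  by (simp add: hsum_def)

lemma hsum_vec_carrier [simp]: "hsum *\<^sub>v x \<in> carrier_vec d"
  by (simp add: hsum_def)

lemma rho_mult_hsum: "h \<in> H \<Longrightarrow> \<rho> h * hsum = hsum"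
  unfolding hsum_def
  by (subst rho_mult_rep_sum) (auto intro!: rep_sum_cong simp: GL2_mult H_mult_left_iff)

lemma hsum_mult_rho: "h \<in> H \<Longrightarrow> hsum * \<rho> h = hsum"
  unfolding hsum_def
  by (subst rep_sum_mult_rho) (auto intro!: rep_sum_cong simp: GL2_mult H_mult_right_iff)

definition fixed where "fixed v \<longleftrightarrow> v \<in> carrier_vec d \<and> (\<forall>h\<in>H. \<rho> h *\<^sub>v v = v)"

lemma fixed_hsum: "x \<in> carrier_vec d \<Longrightarrow> fixed (hsum *\<^sub>v x)"
  by (auto simp: fixed_def rho_mult_hsum simp flip: assoc_mult_mat_vec[of _ d d _ d])

lemma card_H_pos: "card H > 0"
proof -
  have "H \<subseteq> GL" by auto
  then have "finite H" using finite_carrier finite_subset by blast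
  then show ?thesis using lower_in_H[of 0] by (metis card_gt_0_iff empty_iff)
qed

lemma hsum_fixed:
  assumes "fixed v"
  shows "hsum *\<^sub>v v = of_nat (card H) \<cdot>\<^sub>v v"
proof (rule eq_vecI)
  fix i assume "i < dim_vec (of_nat (card H) \<cdot>\<^sub>v v)"
  then have i: "i < d" using assms by (auto simp: fixed_def)
  have "(hsum *\<^sub>v v) $ i = (\<Sum>g\<in>GL. (if g \<in> H then 1 else 0) * (\<rho> g *\<^sub>v v) $ i)"
    unfolding hsum_def using assms i by (subst rep_sum_vec_index) (auto simp: fixed_def)
  also have "\<dots> = (\<Sum>g\<in>GL. if g \<in> H then v $ i else 0)"
    using assms by (intro sum.cong refl) (auto simp: fixed_def simp del: index_mult_mat_vec)
  also have "\<dots> = (\<Sum>g\<in>GL \<inter> H. v $ i)"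
    by (rule sum.inter_restrict[OF finite_carrier, symmetric])
  also have "GL \<inter> H = H" by auto
  finally show "(hsum *\<^sub>v v) $ i = (of_nat (card H) \<cdot>\<^sub>v v) $ i"
    using assms i by (auto simp: fixed_def simp del: index_mult_mat_vec)
qed (use assms in \<open>auto simp: fixed_def hsum_def\<close>)

text \<open>Elements with the same first row differ by a left factor from \<open>H\<close>, which
  \<open>hsum\<close> absorbs.\<close>

lemma hsum_rho_cong:
  assumes "g \<in> GL" "g' \<in> GL" "E0 \<star> g = E0 \<star> g'" "x \<in> carrier_vec d"
  shows "hsum *\<^sub>v (\<rho> g *\<^sub>v x) = hsum *\<^sub>v (\<rho> g' *\<^sub>v x)"
proof -
  have h: "g \<star> inv_p g' \<in> H" by (rule coset_H) fact+
  have "\<rho> g *\<^sub>v x = \<rho> (g \<star> inv_p g') *\<^sub>v (\<rho> g' *\<^sub>v x)"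
    using assms by (simp add: GL_inv_cancel flip: rho_star_vec)
  then have "hsum *\<^sub>v (\<rho> g *\<^sub>v x) = (hsum * \<rho> (g \<star> inv_p g')) *\<^sub>v (\<rho> g' *\<^sub>v x)"
    using assms h by (simp add: assoc_mult_mat_vec[of _ d d _ d])
  then show ?thesis by (simp add: hsum_mult_rho[OF h])
qed

text \<open>Scalar matrices are central, so Schur's lemma applies.\<close>

lemma rho_scalar:
  assumes "\<not> int p dvd a"
  shows "EL a 0 0 a \<in> GL" "\<exists>k. \<rho> (EL a 0 0 a) = k \<cdot>\<^sub>m 1\<^sub>m d"
proof -
  show z: "EL a 0 0 a \<in> GL"
    using prime_p assms by (intro m22_mod_in_GL2) (auto simp: prime_dvd_mult_iff)
  show "\<exists>k. \<rho> (EL a 0 0 a) = k \<cdot>\<^sub>m 1\<^sub>m d"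
  proof (rule schur)
    fix g assume g: "g \<in> GL"
    obtain a' b' c' e' where "g = EL a' b' c' e'" using M2_eq_m22_mod g GL2_in_M2 by blast
    then have "g \<star> EL a 0 0 a = EL a 0 0 a \<star> g" by (simp add: m22_mod_mult mult_ac)
    then show "\<rho> g * \<rho> (EL a 0 0 a) = \<rho> (EL a 0 0 a) * \<rho> g"
      using g z by (simp flip: rho_star)
  qed (use z in simp)
qed

text \<open>The double cosets of \<open>H\<close> are those of the scalar matrices, on which \<open>\<rho>\<close> is scalar, and that of
  \<open>swap\<close>.\<close>
lemma hsum_rho_fixed:
  assumes v: "fixed v" and g: "g \<in> GL"
  shows "\<exists>\<alpha> \<beta>. hsum *\<^sub>v (\<rho> g *\<^sub>v v) = \<alpha> \<cdot>\<^sub>v v + \<beta> \<cdot>\<^sub>v (hsum *\<^sub>v (\<rho> swap *\<^sub>v v))"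
proof -
  have vc: "v \<in> carrier_vec d" using v by (simp add: fixed_def)
  obtain a b c e where g_eq: "g = EL a b c e" using M2_eq_m22_mod g GL2_in_M2 by blast
  show ?thesis
  proof (cases "int p dvd b")
    case True
    then have a: "\<not> int p dvd a"
      using GL2_first_row_nonzero[OF prime_p] g g_eq by blast
    obtain k where k: "\<rho> (EL a 0 0 a) = k \<cdot>\<^sub>m 1\<^sub>m d" using rho_scalar(2)[OF a] by blast
    have "E0 \<star> g = E0 \<star> EL a 0 0 a"
      using True by (simp add: g_eq m22_mod_mult m22_mod_eq_iff cong_0_iff)
    then have "hsum *\<^sub>v (\<rho> g *\<^sub>v v) = hsum *\<^sub>v (k \<cdot>\<^sub>v v)"
      using hsum_rho_cong[OF g rho_scalar(1)[OF a] _ vc] vc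
      by (simp add: k smult_mat_mult_vec[of _ d d])
    also have "\<dots> = (k * of_nat (card H)) \<cdot>\<^sub>v v"
      using vc by (simp add: mult_mat_vec[of _ d d] hsum_fixed[OF v] smult_smult_assoc)
    also have "\<dots> = (k * of_nat (card H)) \<cdot>\<^sub>v v + 0 \<cdot>\<^sub>v (hsum *\<^sub>v (\<rho> swap *\<^sub>v v))"
      using vc by (intro eq_vecI) (auto simp: hsum_def)
    finally show ?thesis by blast
  next
    case False
    have h: "EL 1 0 a b \<in> H"
      using False prime_p by (intro m22_mod_in_H m22_mod_in_GL2) auto
    \<comment> \<open>The product on the right also has first row (a, b), and its right factor lies
      in \<open>H\<close> and so fixes \<open>v\<close>.\<close>
    have "E0 \<star> g = E0 \<star> (swap \<star> EL 1 0 a b)"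
      by (simp add: g_eq m22_mod_mult)
    then have "hsum *\<^sub>v (\<rho> g *\<^sub>v v) = hsum *\<^sub>v (\<rho> (swap \<star> EL 1 0 a b) *\<^sub>v v)"
      using h by (intro hsum_rho_cong g vc) auto
    also have "\<dots> = hsum *\<^sub>v (\<rho> swap *\<^sub>v v)"
      using h v vc by (simp add: rho_star_vec fixed_def)
    also have "\<dots> = 0 \<cdot>\<^sub>v v + 1 \<cdot>\<^sub>v (hsum *\<^sub>v (\<rho> swap *\<^sub>v v))"
      using vc by (intro eq_vecI) (auto simp: hsum_def)
    finally show ?thesis by blast
  qed
qed

text \<open>Since \<open>v\<close> is cyclic, u is a combination of translates of \<open>v\<close>.
  Applying \<open>hsum\<close> multiplies u by the order of \<open>H\<close> and sends each
  translate into the span of two vectors.\<close>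

lemma fixed_span:
  assumes v: "fixed v" "v \<noteq> 0\<^sub>v d" and u: "fixed u"
  shows "\<exists>\<alpha> \<beta>. u = \<alpha> \<cdot>\<^sub>v v + \<beta> \<cdot>\<^sub>v (hsum *\<^sub>v (\<rho> swap *\<^sub>v v))"
proof -
  define y where "y = hsum *\<^sub>v (\<rho> swap *\<^sub>v v)"
  have c: "v \<in> carrier_vec d" "u \<in> carrier_vec d" using u v by (auto simp: fixed_def)
  obtain w where w: "u = rep_sum w *\<^sub>v v" using cyclic[OF c(1) v(2) c(2)] by blast
  obtain \<alpha> \<beta> where ab: "\<And>g. g \<in> GL \<Longrightarrow> hsum *\<^sub>v (\<rho> g *\<^sub>v v) = \<alpha> g \<cdot>\<^sub>v v + \<beta> g \<cdot>\<^sub>v y"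
    using hsum_rho_fixed[OF v(1)] unfolding y_def by metis
  let ?n = "of_nat (card H) :: complex"
  define a where "a = (\<Sum>g\<in>GL. w g * \<alpha> g) / ?n"
  define b where "b = (\<Sum>g\<in>GL. w g * \<beta> g) / ?n"
  have n: "?n \<noteq> 0" using card_H_pos by simp
  have "u = a \<cdot>\<^sub>v v + b \<cdot>\<^sub>v y"
  proof (rule eq_vecI)
    fix i assume "i < dim_vec (a \<cdot>\<^sub>v v + b \<cdot>\<^sub>v y)"
    then have i: "i < d" by (simp add: y_def hsum_def)
    have dy: "dim_vec y = d" by (simp add: y_def hsum_def)
    have "?n * u $ i = (hsum *\<^sub>v (rep_sum w *\<^sub>v v)) $ i"
      using hsum_fixed[OF u] c i by (simp add: w[symmetric] del: index_mult_mat_vec)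
    also have "\<dots> = (\<Sum>g\<in>GL. w g * (hsum *\<^sub>v (\<rho> g *\<^sub>v v)) $ i)"
      using c i by (intro mult_rep_sum_vec_index) auto
    also have "\<dots> = (\<Sum>g\<in>GL. w g * \<alpha> g * v $ i + w g * \<beta> g * y $ i)"
      using c i dy by (intro sum.cong refl) (auto simp: ab algebra_simps simp del: index_mult_mat_vec)
    also have "\<dots> = ?n * (a * v $ i + b * y $ i)"
      using n by (simp add: a_def b_def sum.distrib sum_distrib_right ring_distribs del: index_mult_mat_vec)
    finally have "u $ i = a * v $ i + b * y $ i" using n by simp
    then show "u $ i = (a \<cdot>\<^sub>v v + b \<cdot>\<^sub>v y) $ i"
      using c i dy by (simp del: index_mult_mat_vec)
  qed (use c in \<open>simp add: y_def hsum_def\<close>)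
  then show ?thesis unfolding y_def by blast
qed

text \<open>The operator \<open>Y = hsum * \<rho> swap\<close> maps \<open>H\<close>-fixed vectors to \<open>H\<close>-fixed vectors, and by
  \<open>fixed_span\<close> it satisfies a quadratic equation on \<open>u\<close>. Splitting the quadratic gives an
  \<open>H\<close>-fixed eigenvector \<open>v\<close> of \<open>Y\<close>, and \<open>fixed_span\<close> at \<open>v\<close> then leaves only multiples of \<open>v\<close>.\<close>
lemma fixed_line:
  assumes u: "fixed u" "u \<noteq> 0\<^sub>v d"
  shows "\<exists>v. fixed v \<and> v \<noteq> 0\<^sub>v d \<and> (\<forall>x. fixed x \<longrightarrow> (\<exists>k. x = k \<cdot>\<^sub>v v))"
proof -
  define Y where "Y = hsum * \<rho> swap"
  have Y: "Y \<in> carrier_mat d d" by (simp add: Y_def mult_carrier_mat[of _ d d])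
  have Yv: "hsum *\<^sub>v (\<rho> swap *\<^sub>v x) = Y *\<^sub>v x" if "x \<in> carrier_vec d" for x
    using that by (simp add: Y_def assoc_mult_mat_vec[of _ d d _ d])
  have fixY: "fixed (Y *\<^sub>v x)" if "x \<in> carrier_vec d" for x
    using that fixed_hsum[of "\<rho> swap *\<^sub>v x"] by (simp add: Yv)
  have uc: "u \<in> carrier_vec d" using u by (simp add: fixed_def)
  have Yuc: "Y *\<^sub>v u \<in> carrier_vec d" using fixY[OF uc] by (simp add: fixed_def)
  obtain \<alpha> \<beta> where ab: "Y *\<^sub>v (Y *\<^sub>v u) = \<alpha> \<cdot>\<^sub>v u + \<beta> \<cdot>\<^sub>v (Y *\<^sub>v u)"
    using fixed_span[OF u fixY[OF Yuc]] uc by (auto simp: Yv)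
  \<comment> \<open>\<open>r\<close> and \<open>\<beta> - r\<close> are the roots of X^2 - \<beta> X
    - \<alpha>. Hence either (Y - r) u vanishes and u is an eigenvector for \<open>r\<close>, or it
    is an eigenvector for \<open>\<beta> - r\<close>.\<close>
  define r where "r = (\<beta> + csqrt (\<beta>\<^sup>2 + 4 * \<alpha>)) / 2"
  have r: "r * (\<beta> - r) = - \<alpha>"
  proof -
    have "r * (\<beta> - r) = (\<beta>\<^sup>2 - (csqrt (\<beta>\<^sup>2 + 4 * \<alpha>))\<^sup>2) / 4"
      by (simp add: r_def power2_eq_square field_simps)
    then show ?thesis by simp
  qed
  define v1 where "v1 = Y *\<^sub>v u + (- r) \<cdot>\<^sub>v u"
  have v1: "v1 \<in> carrier_vec d" using uc Yuc by (simp add: v1_def)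
  have Yv1: "Y *\<^sub>v v1 = (\<beta> - r) \<cdot>\<^sub>v v1"
  proof -
    have "Y *\<^sub>v v1 = \<alpha> \<cdot>\<^sub>v u + \<beta> \<cdot>\<^sub>v (Y *\<^sub>v u) + (- r) \<cdot>\<^sub>v (Y *\<^sub>v u)"
      unfolding v1_def using Y uc Yuc
      by (simp add: mult_add_distrib_mat_vec[of _ d d] mult_mat_vec[of _ d d] ab)
    also have "\<dots> = (\<beta> - r) \<cdot>\<^sub>v v1"
    proof (rule eq_vecI)
      fix i assume "i < dim_vec ((\<beta> - r) \<cdot>\<^sub>v v1)"
      then have i: "i < d" using v1 by simp
      have "\<alpha> * u $ i = - (r * (\<beta> - r)) * u $ i" by (simp add: r)
      then show "(\<alpha> \<cdot>\<^sub>v u + \<beta> \<cdot>\<^sub>v (Y *\<^sub>v u) + (- r) \<cdot>\<^sub>v (Y *\<^sub>v u)) $ i = ((\<beta> - r) \<cdot>\<^sub>v v1) $ i"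
        unfolding v1_def using i uc Yuc Y by (simp add: algebra_simps del: index_mult_mat_vec)
    qed (use Y uc Yuc v1 in auto)
    finally show ?thesis .
  qed
  have "\<exists>v \<mu>. fixed v \<and> v \<noteq> 0\<^sub>v d \<and> Y *\<^sub>v v = \<mu> \<cdot>\<^sub>v v"
  proof (cases "v1 = 0\<^sub>v d")
    case True
    have "Y *\<^sub>v u = r \<cdot>\<^sub>v u"
    proof (rule eq_vecI)
      fix i assume "i < dim_vec (r \<cdot>\<^sub>v u)"
      then have i: "i < d" using uc by simp
      have "v1 $ i = 0" using True i by simp
      then show "(Y *\<^sub>v u) $ i = (r \<cdot>\<^sub>v u) $ i"
        unfolding v1_def using i uc Yuc Y by (simp del: index_mult_mat_vec)
    qed (use Y uc Yuc in auto)
    then show ?thesis using u by blast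
  next
    case False
    have "fixed v1"
      using u(1) fixY[OF uc] v1 unfolding fixed_def v1_def
      by (simp add: mult_add_distrib_mat_vec[of _ d d] mult_mat_vec[of _ d d])
    then show ?thesis using False Yv1 by blast
  qed
  then obtain v \<mu> where v: "fixed v" "v \<noteq> 0\<^sub>v d" "Y *\<^sub>v v = \<mu> \<cdot>\<^sub>v v" by blast
  have vc: "v \<in> carrier_vec d" using v by (simp add: fixed_def)
  have "\<exists>k. x = k \<cdot>\<^sub>v v" if x: "fixed x" for x
  proof -
    obtain a b where "x = a \<cdot>\<^sub>v v + b \<cdot>\<^sub>v (\<mu> \<cdot>\<^sub>v v)"
      using fixed_span[OF v(1,2) x] vc v(3) by (auto simp: Yv)
    then have "x = (a + b * \<mu>) \<cdot>\<^sub>v v"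
      using vc by (simp add: add_smult_distrib_vec smult_smult_assoc)
    then show ?thesis ..
  qed
  with v show ?thesis by blast
qed

text \<open>The factor \<open>\<rho> g\<close> comes from moving a general matrix of rank one to
  \<open>E0\<close>. The image of the product lies in the translate by g of the line of fixed
  vectors, so the trace is the eigenvalue there. Without fixed vectors the product is zero.\<close>

lemma cmod_trace_rho_gauss_E0:
  assumes g: "g \<in> GL"
  shows "cmod (mat_trace (\<rho> g * gauss E0)) \<le> real p ^ 3"
    and "mat_trace (\<rho> g * gauss E0) \<noteq> 0 \<Longrightarrow> \<exists>v. fixed v \<and> v \<noteq> 0\<^sub>v d"
proof -
  let ?T = "gauss E0" and ?N = "\<rho> g * gauss E0"
  have N: "?N \<in> carrier_mat d d" using g by (simp add: mult_carrier_mat[of _ d d])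
  have fixT: "fixed (?T *\<^sub>v x)" if x: "x \<in> carrier_vec d" for x
  proof -
    have "\<rho> h *\<^sub>v (?T *\<^sub>v x) = ?T *\<^sub>v x" if h: "h \<in> H" for h
    proof -
      have "\<rho> h * ?T = ?T"
        using rho_mult_gauss[OF H_GL[OF h] E0_M2] h by (simp add: H_def del: H_GL)
      then show ?thesis using h x by (simp flip: assoc_mult_mat_vec[of _ d d _ d])
    qed
    then show ?thesis by (simp add: fixed_def)
  qed
  have *: "cmod (mat_trace ?N) \<le> real p ^ 3 \<and> (mat_trace ?N \<noteq> 0 \<longrightarrow> (\<exists>v. fixed v \<and> v \<noteq> 0\<^sub>v d))"
  proof (cases "\<exists>u. fixed u \<and> u \<noteq> 0\<^sub>v d")
    case False
    have "?N = 0\<^sub>m d d"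
    proof (rule mat_eqI_vec[of _ d d])
      fix x :: "complex vec" assume x: "x \<in> carrier_vec d"
      have "?T *\<^sub>v x = 0\<^sub>v d" using False fixT[OF x] by blast
      then have "?N *\<^sub>v x = \<rho> g *\<^sub>v 0\<^sub>v d" using g x by (simp add: assoc_mult_mat_vec[of _ d d _ d])
      then show "?N *\<^sub>v x = 0\<^sub>m d d *\<^sub>v x"
        using x g by (auto simp: scalar_prod_def intro!: eq_vecI)
    qed (use N in auto)
    then show ?thesis by (simp add: mat_trace_def)
  next
    case True
    then obtain v where v: "fixed v" "v \<noteq> 0\<^sub>v d" "\<And>x. fixed x \<Longrightarrow> \<exists>k. x = k \<cdot>\<^sub>v v"
      using fixed_line by blast
    have vc: "v \<in> carrier_vec d" using v by (simp add: fixed_def)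
    define v' where "v' = \<rho> g *\<^sub>v v"
    have v': "v' \<in> carrier_vec d" using g vc by (simp add: v'_def)
    have pos: "inv_norm2 v' > 0" using g vc v inv_norm2_pos by (simp add: v'_def inv_norm2_rho)
    have "\<exists>k. ?N *\<^sub>v x = k \<cdot>\<^sub>v v'" if x: "x \<in> carrier_vec d" for x
    proof -
      obtain k where "?T *\<^sub>v x = k \<cdot>\<^sub>v v" using v(3) fixT[OF x] by blast
      then have "?N *\<^sub>v x = k \<cdot>\<^sub>v v'"
        using g x vc by (simp add: assoc_mult_mat_vec[of _ d d _ d] mult_mat_vec[of _ d d] v'_def)
      then show ?thesis ..
    qed
    then have eig: "?N *\<^sub>v v' = mat_trace ?N \<cdot>\<^sub>v v'"
      using mult_vec_eq_trace_smult[OF N v'] by blast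
    \<comment> \<open>The first row of \<open>K\<close> is prescribed, so only the second row is
      free.\<close>
    have "card {K \<in> GL. E0 \<star> K = B'} \<le> p\<^sup>2" for B'
    proof -
      let ?f = "\<lambda>K :: int mat. (K $$ (Suc 0, 0), K $$ (Suc 0, Suc 0))"
      have "inj_on ?f {K \<in> GL. E0 \<star> K = B'}"
      proof (rule inj_onI)
        fix K K' assume "K \<in> {K \<in> GL. E0 \<star> K = B'}" "K' \<in> {K \<in> GL. E0 \<star> K = B'}" "?f K = ?f K'"
        then have K: "K \<in> GL" "K' \<in> GL" "E0 \<star> K = E0 \<star> K'"
          "K $$ (Suc 0, 0) = K' $$ (Suc 0, 0)" "K $$ (Suc 0, Suc 0) = K' $$ (Suc 0, Suc 0)" by auto
        obtain a b c e a' b' c' e' where eq: "K = m22 a b c e" "K' = m22 a' b' c' e'"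
          using K(1,2) carrier_mat_2_eq_m22 M2_carrier_mat GL2_in_M2 by meson
        have "K = EL a b c e" "K' = EL a' b' c' e'"
          using mat_mod_M2[of K p] mat_mod_M2[of K' p] K(1,2) by (simp_all add: m22_mod_def eq)
        moreover have "c = c'" "e = e'" using K(4,5) by (simp_all add: eq)
        ultimately show "K = K'"
          using K(3) by (simp add: m22_mod_mult m22_mod_eq_iff)
      qed
      then have "card {K \<in> GL. E0 \<star> K = B'} = card (?f ` {K \<in> GL. E0 \<star> K = B'})"
        by (simp add: card_image)
      also have "\<dots> \<le> card ({0..<int p} \<times> {0..<int p})"
      proof (intro card_mono)
        show "?f ` {K \<in> GL. E0 \<star> K = B'} \<subseteq> {0..<int p} \<times> {0..<int p}"
        proof (rule image_subsetI)
          fix K assume "K \<in> {K \<in> GL. E0 \<star> K = B'}"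
          then have "K \<in> carrier (M2 p)" by simp
          then show "?f K \<in> {0..<int p} \<times> {0..<int p}"
            unfolding carrier_M2 matrix_interval_def by simp
        qed
      qed simp
      finally show ?thesis by (simp add: power2_eq_square)
    qed
    then have "inv_norm2 (?T *\<^sub>v v') \<le> real (p\<^sup>2) * real p ^ 4 * inv_norm2 v'"
      by (intro inv_norm2_gauss_le v' E0_M2)
    moreover have "inv_norm2 (?T *\<^sub>v v') = inv_norm2 (?N *\<^sub>v v')"
      using g v' by (simp add: assoc_mult_mat_vec[of _ d d _ d] inv_norm2_rho)
    ultimately have "(cmod (mat_trace ?N))\<^sup>2 * inv_norm2 v' \<le> (real p ^ 3)\<^sup>2 * inv_norm2 v'"
      using v' by (simp add: eig inv_norm2_smult flip: power_add power_mult)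
    then have "(cmod (mat_trace ?N))\<^sup>2 \<le> (real p ^ 3)\<^sup>2"
      using pos by simp
    then have "cmod (mat_trace ?N) \<le> real p ^ 3"
      by (rule power2_le_imp_le) simp
    with True show ?thesis by blast
  qed
  show "cmod (mat_trace ?N) \<le> real p ^ 3" using * by blast
  show "mat_trace ?N \<noteq> 0 \<Longrightarrow> \<exists>v. fixed v \<and> v \<noteq> 0\<^sub>v d" using * by blast
qed


section \<open>Transvections and the lower bound for the dimension\<close>

abbreviation lower where "lower c \<equiv> EL 1 0 c 1"

lemma lower_add: "lower b \<star> lower c = lower (b + c)"
  by (simp add: m22_mod_mult)

lemma rho_lower_power:
  assumes x: "x \<in> carrier_vec d" and ev: "\<rho> (lower 1) *\<^sub>v x = k \<cdot>\<^sub>v x"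
  shows "\<rho> (lower (int n)) *\<^sub>v x = k ^ n \<cdot>\<^sub>v x"
proof (induction n)
  case 0
  have "lower 0 = \<one>\<^bsub>GL2 p\<^esub>" using p_gt_1 by (simp add: GL2_one one_M2)
  then show ?case using x by simp
next
  case (Suc n)
  have "lower (int (Suc n)) = lower (int n) \<star> lower 1" by (simp add: lower_add add.commute)
  then have "\<rho> (lower (int (Suc n))) *\<^sub>v x = \<rho> (lower (int n)) *\<^sub>v (k \<cdot>\<^sub>v x)"
    using x ev by (simp add: rho_star_vec)
  also have "\<dots> = k ^ Suc n \<cdot>\<^sub>v x"
    using x Suc by (simp add: mult_mat_vec[of _ d d] smult_smult_assoc)
  finally show ?case .
qed

text \<open>If this transvection acted trivially, so would all lower unitriangular matrices and,
  conjugating by \<open>swap\<close>, all upper ones. Right multiplication by these brings every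
  invertible matrix into \<open>H\<close>, so \<open>v\<close> would be fixed by the whole
  group.\<close>

lemma rho_lower_ne_1:
  assumes v: "fixed v" "v \<noteq> 0\<^sub>v d" and nontriv: "\<not> trivial_representation (GL2 p) d \<rho>"
  shows "\<exists>x\<in>carrier_vec d. \<rho> (lower 1) *\<^sub>v x \<noteq> x"
proof (rule ccontr)
  assume "\<not> ?thesis"
  then have one: "\<rho> (lower 1) *\<^sub>v x = 1 \<cdot>\<^sub>v x" if "x \<in> carrier_vec d" for x using that by simp
  have lower: "\<rho> (lower c) *\<^sub>v x = x" if x: "x \<in> carrier_vec d" for c x
  proof -
    have "lower c = lower (int (nat (c mod int p)))"
      using p_pos by (simp add: m22_mod_eq_iff)
    then show ?thesis using rho_lower_power[OF x one[OF x], of "nat (c mod int p)"] x p_pos by simp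
  qed
  have upper_GL: "EL 1 c 0 1 \<in> GL" for c
    using prime_p by (intro m22_mod_in_GL2) auto
  have upper: "\<rho> (EL 1 c 0 1) *\<^sub>v x = x" if x: "x \<in> carrier_vec d" for c x
  proof -
    have "EL 1 c 0 1 = swap \<star> (lower c \<star> swap)" by (simp add: m22_mod_mult)
    then have "\<rho> (EL 1 c 0 1) *\<^sub>v x = \<rho> (swap \<star> swap) *\<^sub>v x"
      using x by (simp add: rho_star_vec lower)
    also have "swap \<star> swap = \<one>\<^bsub>GL2 p\<^esub>" using p_gt_1 by (simp add: GL2_one one_M2 m22_mod_mult)
    finally show ?thesis using x by simp
  qed
  have vc: "v \<in> carrier_vec d" using v by (simp add: fixed_def)
  \<comment> \<open>A first row (1, b) becomes (1, 0) after an upper unitriangular factor.\<close>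
  have A: "\<rho> (EL a b c e) *\<^sub>v v = v"
    if "EL a b c e \<in> GL" "[a = 1] (mod int p)" for a b c e
  proof -
    have "EL a b c e \<star> EL 1 (- b) 0 1 \<in> GL" using that(1) upper_GL by simp
    moreover have "[a * - b + b = 0] (mod int p)"
    proof -
      have "[a * - b + b = 1 * - b + b] (mod int p)"
        by (intro cong_add cong_mult that(2) cong_refl)
      then show ?thesis by simp
    qed
    ultimately have "EL a b c e \<star> EL 1 (- b) 0 1 \<in> H"
      using that(2) unfolding m22_mod_mult by (intro m22_mod_in_H) auto
    then have "\<rho> (EL a b c e \<star> EL 1 (- b) 0 1) *\<^sub>v v = v" using v(1) by (simp add: fixed_def)
    then show ?thesis using that(1) vc by (simp add: rho_star_vec upper_GL upper)
  qed
  \<comment> \<open>If b is invertible, a lower unitriangular factor makes the top left entry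
    1.\<close>
  have B: "\<rho> (EL a b c e) *\<^sub>v v = v" if g: "EL a b c e \<in> GL" "\<not> int p dvd b" for a b c e
  proof -
    obtain u where u: "[b * u = 1] (mod int p)" using cong_inverse_exists[OF prime_p g(2)] by blast
    let ?n = "lower (u * (1 - a))"
    have "EL a b c e \<star> ?n \<in> GL" using g(1) by simp
    moreover have "[a * 1 + b * (u * (1 - a)) = 1] (mod int p)"
    proof -
      have "[a * 1 + (b * u) * (1 - a) = a * 1 + 1 * (1 - a)] (mod int p)"
        by (intro cong_add cong_mult u cong_refl)
      then show ?thesis by (simp add: mult.assoc)
    qed
    ultimately have "\<rho> (EL a b c e \<star> ?n) *\<^sub>v v = v" unfolding m22_mod_mult by (rule A)
    then show ?thesis using g(1) vc by (simp add: rho_star_vec lower)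
  qed
  have "\<rho> g *\<^sub>v v = v" if g: "g \<in> GL" for g
  proof -
    obtain a b c e where g_eq: "g = EL a b c e" using M2_eq_m22_mod g GL2_in_M2 by blast
    show ?thesis
    proof (cases "int p dvd b")
      case False
      then show ?thesis using B g g_eq by blast
    next
      case True
      then have "\<not> int p dvd a" using GL2_first_row_nonzero[OF prime_p] g g_eq by blast
      then have "\<not> int p dvd a * 1 + b * 1" using True by (simp add: dvd_add_left_iff)
      \<comment> \<open>This factor replaces b by a + b, which is invertible because b vanishes and
        a does not.\<close>
      moreover have "g \<star> EL 1 1 0 1 \<in> GL" using g upper_GL by simp
      ultimately have "\<rho> (g \<star> EL 1 1 0 1) *\<^sub>v v = v"
        unfolding g_eq m22_mod_mult by (intro B)
      then show ?thesis using g vc by (simp add: rho_star_vec upper_GL upper)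
    qed
  qed
  then show False using fixed_vector_imp_trivial[OF vc v(2)] nontriv by blast
qed

text \<open>The conjugate of the character c \<mapsto> \<psi>(\<xi> c) of the lower unitriangular
  group, extended by zero. Membership is tested by rebuilding the matrix from its lower left
  entry.\<close>

definition lower_char :: "int \<Rightarrow> int mat \<Rightarrow> complex" where
  "lower_char \<xi> g = (if g = lower (g $$ (Suc 0, 0)) then add_char p (- (\<xi> * g $$ (Suc 0, 0))) else 0)"

lemma lower_char_lower: "lower_char \<xi> (lower c) = add_char p (- (\<xi> * c))"
proof -
  have "lower c $$ (Suc 0, 0) = c mod int p" by (simp add: m22_mod_def mat_mod_m22)
  moreover have "lower c = lower (c mod int p)" by (simp add: m22_mod_eq_iff)
  ultimately show ?thesis
    unfolding lower_char_def
    by (auto intro!: add_char_cong[OF p_pos] cong_mult simp: cong_minus_minus_iff)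
qed

text \<open>This makes every vector in the image of \<open>rep_sum (lower_char \<xi>)\<close>
  satisfy the eigenvalue equation of the transvection for \<psi>(\<xi>).\<close>

lemma lower_char_translate:
  assumes g: "g \<in> GL"
  shows "lower_char \<xi> (inv_p (lower 1) \<star> g) = add_char p \<xi> * lower_char \<xi> g"
proof (cases "\<exists>c. g = lower c")
  case True
  then obtain c where c: "g = lower c" by blast
  have "lower 1 \<star> lower (c - 1) = lower c" by (simp add: lower_add)
  then have "inv_p (lower 1) \<star> g = lower (c - 1)"
    using c GL_inv_cancel(2)[of "lower 1" "lower (c - 1)"] by simp
  then show ?thesis
    using c by (simp add: lower_char_lower algebra_simps flip: add_char_add)
next
  case False
  have "\<not> (\<exists>c. inv_p (lower 1) \<star> g = lower c)"
  proof
    assume "\<exists>c. inv_p (lower 1) \<star> g = lower c"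
    then obtain c where "inv_p (lower 1) \<star> g = lower c" by blast
    then have "lower 1 \<star> lower c = g" using GL_inv_cancel(1)[of "lower 1" g] g by simp
    then show False using False lower_add by metis
  qed
  then show ?thesis using False unfolding lower_char_def by (metis mult_zero_right)
qed

text \<open>Character orthogonality, by which the isotypic projections add up to the identity
  operator.\<close>

lemma lower_char_sum:
  assumes "g \<in> GL"
  shows "(\<Sum>\<xi>\<in>{0..<int p}. lower_char \<xi> g) = (if g = \<one>\<^bsub>GL2 p\<^esub> then of_nat p else 0)"
proof -
  have one: "\<one>\<^bsub>GL2 p\<^esub> = lower 0" using p_gt_1 by (simp add: GL2_one one_M2)
  show ?thesis
  proof (cases "\<exists>c. g = lower c")
    case True
    then obtain c where c: "g = lower c" by blast
    have "(\<Sum>\<xi>\<in>{0..<int p}. lower_char \<xi> g) = (\<Sum>\<xi>\<in>{0..<int p}. add_char p (- c * \<xi>))"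
      by (simp add: c lower_char_lower mult.commute)
    also have "\<dots> = (if int p dvd - c then of_nat p else 0)"
      by (rule add_char_orthogonality[OF p_pos])
    finally show ?thesis by (simp add: c one m22_mod_eq_iff cong_0_iff)
  next
    case False
    then have "lower_char \<xi> g = 0" for \<xi> by (auto simp: lower_char_def)
    then show ?thesis using False one by auto
  qed
qed

text \<open>\<open>rep_sum (lower_char \<xi>)\<close> is \<open>p\<close> times the projection to the \<open>\<xi>\<close>-isotypic part under the group of
  lower unitriangular matrices.\<close>
lemma rho_lower_eigenvector:
  assumes x: "x \<in> carrier_vec d" and ne: "\<rho> (lower 1) *\<^sub>v x \<noteq> x"
  shows "\<exists>\<xi>\<in>{1..<int p}. \<exists>y\<in>carrier_vec d. y \<noteq> 0\<^sub>v d \<and> \<rho> (lower 1) *\<^sub>v y = add_char p \<xi> \<cdot>\<^sub>v y"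
proof -
  define y where "y \<xi> = rep_sum (lower_char \<xi>) *\<^sub>v x" for \<xi>
  have yc: "y \<xi> \<in> carrier_vec d" for \<xi> by (simp add: y_def)
  have ev: "\<rho> (lower 1) *\<^sub>v y \<xi> = add_char p \<xi> \<cdot>\<^sub>v y \<xi>" for \<xi>
  proof -
    have "\<rho> (lower 1) *\<^sub>v y \<xi> = (\<rho> (lower 1) * rep_sum (lower_char \<xi>)) *\<^sub>v x"
      using x by (simp add: y_def assoc_mult_mat_vec[of _ d d _ d])
    also have "\<rho> (lower 1) * rep_sum (lower_char \<xi>) = rep_sum (\<lambda>g. add_char p \<xi> * lower_char \<xi> g)"
      by (subst rho_mult_rep_sum) (auto intro!: rep_sum_cong simp: GL2_mult lower_char_translate)
    also have "\<dots> *\<^sub>v x = add_char p \<xi> \<cdot>\<^sub>v y \<xi>"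
      using x by (simp add: y_def rep_sum_smult_vec)
    finally show ?thesis .
  qed
  \<comment> \<open>If all components with \<xi> non-zero vanished, p x would equal its component at
    0, which the transvection fixes.\<close>
  have "\<exists>\<xi>\<in>{1..<int p}. y \<xi> \<noteq> 0\<^sub>v d"
  proof (rule ccontr)
    assume "\<not> ?thesis"
    then have zero: "y \<xi> = 0\<^sub>v d" if "\<xi> \<in> {1..<int p}" for \<xi> using that by blast
    have "y 0 = of_nat p \<cdot>\<^sub>v x"
    proof (rule eq_vecI)
      fix i assume "i < dim_vec (of_nat p \<cdot>\<^sub>v x)"
      then have i: "i < d" using x by simp
      have "(\<Sum>\<xi>\<in>{0..<int p}. y \<xi> $ i)
          = (\<Sum>\<xi>\<in>{0..<int p}. \<Sum>g\<in>GL. lower_char \<xi> g * (\<rho> g *\<^sub>v x) $ i)"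
        using x i by (simp add: y_def rep_sum_vec_index del: index_mult_mat_vec)
      also have "\<dots> = (\<Sum>g\<in>GL. (\<Sum>\<xi>\<in>{0..<int p}. lower_char \<xi> g) * (\<rho> g *\<^sub>v x) $ i)"
        by (subst sum.swap) (simp add: sum_distrib_right del: index_mult_mat_vec)
      also have "\<dots> = (\<Sum>g\<in>GL. if g = \<one>\<^bsub>GL2 p\<^esub> then of_nat p * x $ i else 0)"
        using x by (intro sum.cong refl) (auto simp: lower_char_sum simp del: index_mult_mat_vec)
      also have "\<dots> = of_nat p * x $ i"
        using finite_carrier one_closed by (simp add: sum.delta)
      finally have "(\<Sum>\<xi>\<in>{0..<int p}. y \<xi> $ i) = of_nat p * x $ i" .
      moreover have "{0..<int p} = insert 0 {1..<int p}" using p_pos by auto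
      ultimately show "y 0 $ i = (of_nat p \<cdot>\<^sub>v x) $ i"
        using x i by (simp add: zero)
    qed (use x yc in auto)
    then have "\<rho> (lower 1) *\<^sub>v (of_nat p \<cdot>\<^sub>v x) = of_nat p \<cdot>\<^sub>v x"
      using ev[of 0] x by simp
    then have "of_nat p \<cdot>\<^sub>v (\<rho> (lower 1) *\<^sub>v x) = of_nat p \<cdot>\<^sub>v x"
      using x by (simp add: mult_mat_vec[of _ d d])
    then have "inverse (of_nat p) \<cdot>\<^sub>v (of_nat p \<cdot>\<^sub>v (\<rho> (lower 1) *\<^sub>v x))
        = inverse (of_nat p) \<cdot>\<^sub>v (of_nat p \<cdot>\<^sub>v x)" by simp
    then show False using ne p_pos by (simp add: smult_smult_assoc)
  qed
  then show ?thesis using ev yc by blast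
qed

text \<open>The transvection has the eigenvalue 1 on \<open>v\<close> and some \<psi>(\<xi>)
  different from 1. Conjugation by diagonal matrices turns the latter into all non-trivial p-th
  roots of unity, and a d by d matrix has at most d eigenvalues.\<close>

lemma dim_ge_p:
  assumes v: "fixed v" "v \<noteq> 0\<^sub>v d" and nontriv: "\<not> trivial_representation (GL2 p) d \<rho>"
  shows "p \<le> d"
proof -
  let ?L = "\<rho> (lower 1)"
  have vc: "v \<in> carrier_vec d" using v by (simp add: fixed_def)
  obtain \<xi> y where \<xi>: "\<xi> \<in> {1..<int p}" and y: "y \<in> carrier_vec d" "y \<noteq> 0\<^sub>v d"
    "?L *\<^sub>v y = add_char p \<xi> \<cdot>\<^sub>v y"
    using rho_lower_ne_1[OF assms] rho_lower_eigenvector by blast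
  have \<xi>': "\<not> int p dvd \<xi>" using \<xi> zdvd_imp_le[of "int p" \<xi>] by auto
  let ?S = "(\<lambda>z. add_char p (\<xi> * int z)) ` {..<p}"
  have "add_char p (\<xi> * int z) \<in> spectrum ?L" if z: "z < p" for z
  proof (cases "z = 0")
    case True
    have "?L *\<^sub>v v = 1 \<cdot>\<^sub>v v" using v by (simp add: fixed_def)
    then show ?thesis
      using True v vc by (auto simp: spectrum_def eigenvalue_def eigenvector_def)
  next
    case False
    then have "\<not> int p dvd int z" using z by (auto dest: dvd_imp_le)
    then obtain u where u: "[int z * u = 1] (mod int p)"
      using cong_inverse_exists[OF prime_p] by blast
    then have "\<not> int p dvd int z * u"
      using p_gt_1 by (metis cong_dvd_iff nat_dvd_1_iff_1 int_dvd_int_iff of_nat_1 less_irrefl)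
    then have s: "EL 1 0 0 u \<in> GL"
      using prime_p by (intro m22_mod_in_GL2) auto
    \<comment> \<open>As u inverts z, the diagonal matrix conjugates \<open>lower (int z)\<close> to
      \<open>lower 1\<close>, so the translate of y has eigenvalue \<psi>(\<xi>)^z.\<close>
    have "lower 1 \<star> EL 1 0 0 u = EL 1 0 0 u \<star> lower (int z)"
      using u by (simp add: m22_mod_mult m22_mod_eq_iff mult.commute cong_sym)
    then have "?L *\<^sub>v (\<rho> (EL 1 0 0 u) *\<^sub>v y) = \<rho> (EL 1 0 0 u) *\<^sub>v (\<rho> (lower (int z)) *\<^sub>v y)"
      using s y by (simp flip: rho_star_vec)
    also have "\<dots> = add_char p (\<xi> * int z) \<cdot>\<^sub>v (\<rho> (EL 1 0 0 u) *\<^sub>v y)"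
      using s y by (simp add: rho_lower_power[OF y(1,3)] mult_mat_vec[of _ d d] add_char_power)
    finally have "?L *\<^sub>v (\<rho> (EL 1 0 0 u) *\<^sub>v y) = add_char p (\<xi> * int z) \<cdot>\<^sub>v (\<rho> (EL 1 0 0 u) *\<^sub>v y)" .
    moreover have "\<rho> (EL 1 0 0 u) *\<^sub>v y \<noteq> 0\<^sub>v d"
    proof
      assume *: "\<rho> (EL 1 0 0 u) *\<^sub>v y = 0\<^sub>v d"
      have "0 \<cdot>\<^sub>v y = 0\<^sub>v d" using y(1) by auto
      then have "inv_norm2 y = inv_norm2 (0 \<cdot>\<^sub>v y)"
        using inv_norm2_rho[OF s y(1)] * by simp
      then show False using inv_norm2_pos[OF y(1,2)] y(1) by (simp only: inv_norm2_smult) simp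
    qed
    ultimately show ?thesis
      using s y unfolding spectrum_def eigenvalue_def eigenvector_def
      by (auto intro!: exI[of _ "\<rho> (EL 1 0 0 u) *\<^sub>v y"])
  qed
  then have "?S \<subseteq> spectrum ?L" by auto
  then have "card ?S \<le> d"
    using card_finite_spectrum[of ?L d] card_mono order_trans by (metis lower_in_GL rho_carrier)
  moreover have "inj_on (\<lambda>z. add_char p (\<xi> * int z)) {..<p}"
  proof (rule inj_onI)
    fix z z' assume z: "z \<in> {..<p}" "z' \<in> {..<p}"
      and eq: "add_char p (\<xi> * int z) = add_char p (\<xi> * int z')"
    have "add_char p (\<xi> * int z - \<xi> * int z')
        = add_char p (\<xi> * int z') * cnj (add_char p (\<xi> * int z'))"
      unfolding add_char_diff by (simp only: eq)
    also have "\<dots> = 1" by (simp flip: complex_norm_square)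
    finally have "int p dvd \<xi> * (int z - int z')"
      using p_pos by (simp add: add_char_eq_1_iff right_diff_distrib)
    then have "int p dvd int z - int z'" using \<xi>' prime_p by (simp add: prime_dvd_mult_iff)
    then have "[z = z'] (mod p)" by (simp add: cong_iff_dvd_diff flip: cong_int_iff)
    then show "z = z'" using z by (simp add: cong_less_modulus_unique_nat)
  qed
  ultimately show ?thesis by (simp add: card_image)
qed

section \<open>The uniform Gauss sum bound and the incomplete character sum\<close>

text \<open>In rank one, B = P E0 Q gives G(B) = \<rho>(Q)^-1 G(E0) \<rho>(P)^-1, and cyclicity of
  the trace collects the outer factors on one side.\<close>

lemma cmod_trace_gauss_le:
  assumes nontriv: "\<not> trivial_representation (GL2 p) d \<rho>" and B: "B \<in> carrier (M2 p)"
  shows "cmod (mat_trace (gauss B)) \<le> real d * real p ^ 2"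
proof (cases rule: M2_singular_cases[OF prime_p B])
  case 1
  then show ?thesis by (rule cmod_trace_gauss_invertible)
next
  case 2
  then show ?thesis using gauss_zero[OF nontriv] by (simp add: mat_trace_def)
next
  case (3 P Q)
  let ?g = "inv_p P \<star> inv_p Q"
  have EQ: "E0 \<star> Q \<in> carrier (M2 p)" using 3 by simp
  have 4: "\<rho> Q * gauss (E0 \<star> Q) = gauss E0" using rho_mult_gauss[OF 3(2) E0_M2] .
  have 5: "gauss B * \<rho> P = gauss (E0 \<star> Q)" using gauss_mult_rho[OF 3(1) EQ] 3(3) by simp
  have "mat_trace (\<rho> ?g * gauss E0)
      = mat_trace (\<rho> (inv_p P) * (\<rho> (inv_p Q) * (\<rho> Q * (gauss B * \<rho> P))))"
    unfolding 5 4 using 3 by (simp add: rho_star assoc_mult_mat[of _ d d _ d _ d])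
  also have "\<rho> (inv_p Q) * (\<rho> Q * (gauss B * \<rho> P)) = gauss B * \<rho> P"
    using 3(1,2) rho_inv[OF 3(2)] left_mult_one_mat[OF gauss_carrier]
    by (simp add: assoc_mult_mat[of _ d d _ d _ d, symmetric] mult_carrier_mat[of _ d d])
  also have "mat_trace (\<rho> (inv_p P) * (gauss B * \<rho> P)) = mat_trace (gauss B * \<rho> P * \<rho> (inv_p P))"
    using 3 by (intro mat_trace_mult_comm[of _ d d]) (auto simp: mult_carrier_mat[of _ d d])
  also have "gauss B * \<rho> P * \<rho> (inv_p P) = gauss B"
    using 3 by (simp add: assoc_mult_mat[of _ d d _ d _ d] rho_inv right_mult_one_mat[of _ d d])
  finally have tr: "mat_trace (gauss B) = mat_trace (\<rho> ?g * gauss E0)" ..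
  have g: "?g \<in> GL" using 3 by simp
  show ?thesis
  \<comment> \<open>A non-zero trace forces an \<open>H\<close>-fixed vector, hence d \<ge> p, and
    then the bound p^3 is at most d p^2.\<close>
  proof (cases "mat_trace (gauss B) = 0")
    case False
    then obtain v where "fixed v" "v \<noteq> 0\<^sub>v d"
      using cmod_trace_rho_gauss_E0(2)[OF g] tr by auto
    then have "p \<le> d" using dim_ge_p nontriv by blast
    then have "real p ^ 3 \<le> real d * real p ^ 2"
      by (simp add: power3_eq_cube power2_eq_square mult.assoc mult_right_mono)
    then show ?thesis using cmod_trace_rho_gauss_E0(1)[OF g] tr by simp
  qed simp
qed


text \<open>Identifies the Fourier coefficients of the character extended by zero, as required for
  completion.\<close>

lemma sum_char_GL2:
  "(\<Sum>A\<in>carrier (M2 p). phase p A B * char_GL2 p \<rho> A) = mat_trace (gauss B)"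
proof -
  have "(\<Sum>A\<in>carrier (M2 p). phase p A B * char_GL2 p \<rho> A)
      = (\<Sum>A\<in>GL. phase p A B * char_GL2 p \<rho> A)"
    by (rule sum.mono_neutral_right) (auto simp: finite_M2 char_GL2_def)
  also have "\<dots> = (\<Sum>A\<in>GL. phase p A B * mat_trace (\<rho> A))"
    by (intro sum.cong refl) (simp add: char_GL2_def)
  also have "\<dots> = mat_trace (gauss B)"
    by (simp add: gauss_def mat_trace_rep_sum)
  finally show ?thesis .
qed

text \<open>Completion with \<open>F = d p^2\<close> and \<open>L = C ln p\<close>. The hypothesis
  on \<open>C\<close> absorbs the interval length, at most c p, and the bound p (1 + ln p) for the
  other frequencies.\<close>

lemma incomplete_character_sum_le:
  assumes nontriv: "\<not> trivial_representation (GL2 p) d \<rho>"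
    and I: "\<And>i j. i < 2 \<Longrightarrow> j < 2 \<Longrightarrow> \<exists>u v. I i j = {u..v}"
    and card: "\<And>i j. i < 2 \<Longrightarrow> j < 2 \<Longrightarrow> real (card (I i j)) \<le> c * real p"
    and C: "c + 1 + ln (real p) \<le> C * ln (real p)"
  shows "cmod (\<Sum>A\<in>matrix_interval I. char_GL2 p \<rho> A)
           \<le> C ^ 4 * real d * real p ^ 2 * ln (real p) ^ 4"
proof -
  have "cmod (\<Sum>A\<in>matrix_interval I. char_GL2 p \<rho> A) \<le> real d * real p ^ 2 * (C * ln (real p)) ^ 4"
  proof (rule incomplete_sum_le[OF p_gt_1 _ _ I])
    fix i j :: nat assume ij: "i < 2" "j < 2"
    have "real p * (c + 1 + ln (real p)) \<le> real p * (C * ln (real p))"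
      using C by (intro mult_left_mono) auto
    then show "real (card (I i j)) + real p * (1 + ln (real p)) \<le> real p * (C * ln (real p))"
      using card[OF ij] by (simp add: algebra_simps)
  next
    fix B assume "B \<in> carrier (M2 p)"
    then show "cmod (\<Sum>A\<in>carrier (M2 p). phase p A B * char_GL2 p \<rho> A) \<le> real d * real p ^ 2"
      unfolding sum_char_GL2 by (rule cmod_trace_gauss_le[OF nontriv])
  qed (simp_all add: char_GL2_def)
  then show ?thesis by (simp add: power_mult_distrib mult_ac)
qed

end

theorem theorem1p4:
  fixes c :: real
  assumes "c > 0"
  shows "\<exists>C>0. \<forall>(p::nat) (d::nat) (\<rho> :: int mat \<Rightarrow> complex mat) (I :: nat \<Rightarrow> nat \<Rightarrow> int set).
    prime p \<and> odd p
    \<and> irreducible_representation (GL2 p) d \<rho> \<and> \<not> trivial_representation (GL2 p) d \<rho>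
    \<and> (\<forall>i<2. \<forall>j<2. (\<exists>a b. I i j = {a..b}) \<and> real (card (I i j)) \<le> c * real p)
    \<longrightarrow> cmod (\<Sum>A\<in>matrix_interval I. char_GL2 p \<rho> A) \<le> C * real d * real p ^ 2 * ln (real p) ^ 4
      \<and> (p \<ge> 11 \<longrightarrow>
          cmod (\<Sum>A\<in>matrix_interval I. char_GL2 p \<rho> A)
            \<le> ((c + 3) / 2) ^ 4 * real d * real p ^ 2 * ln (real p) ^ 4)"
proof (intro exI[of _ "(c + 2) ^ 4"] conjI allI impI)
  show "(c + 2) ^ 4 > 0" using assms by simp
next
  fix p d :: nat and \<rho> :: "int mat \<Rightarrow> complex mat" and I :: "nat \<Rightarrow> nat \<Rightarrow> int set"
  assume *: "prime p \<and> odd p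
    \<and> irreducible_representation (GL2 p) d \<rho> \<and> \<not> trivial_representation (GL2 p) d \<rho>
    \<and> (\<forall>i<2. \<forall>j<2. (\<exists>a b. I i j = {a..b}) \<and> real (card (I i j)) \<le> c * real p)"
  then interpret gl2_irrep p d \<rho> by unfold_locales auto
  have bound: "cmod (\<Sum>A\<in>matrix_interval I. char_GL2 p \<rho> A)
      \<le> C ^ 4 * real d * real p ^ 2 * ln (real p) ^ 4" if "c + 1 + ln (real p) \<le> C * ln (real p)" for C
    using * that by (intro incomplete_character_sum_le[where c = c]) auto
  have "p \<noteq> 2" using * by auto
  \<comment> \<open>From p \<ge> 3 \<ge> e follows ln p \<ge> 1, so c + 1 + ln p \<le> (c + 2) ln
    p.\<close>
  then have "real p \<ge> 3" using p_gt_1 by linarith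
  then have ln1: "ln (real p) \<ge> 1"
    using exp_le by (subst ln_ge_iff) auto
  have "c * 1 \<le> c * ln (real p)" using assms ln1 by (intro mult_left_mono) auto
  then show "cmod (\<Sum>A\<in>matrix_interval I. char_GL2 p \<rho> A)
      \<le> (c + 2) ^ 4 * real d * real p ^ 2 * ln (real p) ^ 4"
    using ln1 by (intro bound) (simp add: algebra_simps)
  assume p: "p \<ge> 11"
  \<comment> \<open>Now e^2 \<le> 9 < p gives ln p \<ge> 2, so c + 1 is at most half of (c + 1) ln p
    and the constant improves to (c + 1) / 2 + 1 = (c + 3) / 2.\<close>
  have "exp 2 = (exp 1 :: real) ^ 2" by (simp flip: exp_of_nat_mult)
  also have "\<dots> \<le> 3 ^ 2" using exp_le by (intro power_mono) auto
  finally have ln2: "ln (real p) \<ge> 2"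
    using p by (subst ln_ge_iff) auto
  have "c * 2 \<le> c * ln (real p)" using assms ln2 by (intro mult_left_mono) auto
  then show "cmod (\<Sum>A\<in>matrix_interval I. char_GL2 p \<rho> A)
      \<le> ((c + 3) / 2) ^ 4 * real d * real p ^ 2 * ln (real p) ^ 4"
    using ln2 by (intro bound) (simp add: field_simps)
qed

end
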